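(* There exist absolute constants $C, C'>0$ such that the following holds. Let $q$ be a positive integer, and let $A,B\subset \mathbb{Z}_q$ be nonempty sets with $|A|=\alpha q$, $|B|=\beta q$ and $\alpha\ge\beta$. Then there is a divisor $d\mid q$ with $$d\le C'\exp(C\beta^{-4})$$ such that $$d\cdot \mathbb{Z}_q\subseteq (A-A)(B-B).$$
   Context: $\mathbb{Z}_q=\mathbb{Z}/q\mathbb{Z}$. For $X,Y\subseteq\mathbb{Z}_q$: $X-Y=\{x-y: x\in X, y\in Y\}$, $XY=\{xy: x\in X,y\in Y\}$ (so $(A-A)(B-B)$ is the set of products of one element of $A-A$ and one element of $B-B$), and $d\cdot X=\{dx: x\in X\}$. *)

theory Defs
  imports Complex_Main "HOL-Number_Theory.Residues"
begin

text \<open>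
  The ring \<open>\<int>/q\<int>\<close> is \<^const>\<open>residue_ring\<close>, whose carrier is \<open>{0..q-1}\<close>. For \<open>q = 1\<close> the locale
  \<open>residues\<close> does not apply, because the field \<open>one\<close> of the record lies outside the carrier.
  Only the carrier, addition, subtraction and multiplication are used below, and these are the
  intended ones for every \<open>q > 0\<close>; lemmas \<open>Zq_minus\<close> and \<open>Zq_add_pow\<close> cover \<open>q = 1\<close>.
\<close>

abbreviation Zq :: "nat \<Rightarrow> int ring"
  where "Zq q \<equiv> residue_ring (int q)"

definition set_minus :: "('a, 'm) ring_scheme \<Rightarrow> 'a set \<Rightarrow> 'a set \<Rightarrow> 'a set"
  where "set_minus R X Y = {x \<ominus>\<^bsub>R\<^esub> y | x y. x \<in> X \<and> y \<in> Y}"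

text \<open>
  The dilation \<open>d \<cdot> X\<close> uses the integer multiple \<open>[d] \<cdot>\<^bsub>R\<^esub> x = x + \<dots> + x\<close>, so that \<open>d\<close> need not
  be reduced modulo \<open>q\<close>; in particular \<open>d = q\<close> is allowed and gives \<open>{0}\<close>.
\<close>

definition dilate :: "('a, 'm) ring_scheme \<Rightarrow> nat \<Rightarrow> 'a set \<Rightarrow> 'a set"
  where "dilate R d X = {[d] \<cdot>\<^bsub>R\<^esub> x | x. x \<in> X}"

lemma Zq_minus:
  assumes "q > 0" "x \<in> carrier (Zq q)" "y \<in> carrier (Zq q)"
  shows "x \<ominus>\<^bsub>Zq q\<^esub> y = (x - y) mod int q"
proof -
  have "\<ominus>\<^bsub>Zq q\<^esub> y = (- y) mod int q"
    unfolding a_inv_def m_inv_def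
  proof (rule the_equality)
    show "(- y) mod int q \<in> carrier (add_monoid (Zq q)) \<and>
        y \<otimes>\<^bsub>add_monoid (Zq q)\<^esub> ((- y) mod int q) = \<one>\<^bsub>add_monoid (Zq q)\<^esub> \<and>
        ((- y) mod int q) \<otimes>\<^bsub>add_monoid (Zq q)\<^esub> y = \<one>\<^bsub>add_monoid (Zq q)\<^esub>"
      using assms(1) by (simp add: residue_ring_def mod_simps)
  next
    fix z
    assume z: "z \<in> carrier (add_monoid (Zq q)) \<and>
        y \<otimes>\<^bsub>add_monoid (Zq q)\<^esub> z = \<one>\<^bsub>add_monoid (Zq q)\<^esub> \<and>
        z \<otimes>\<^bsub>add_monoid (Zq q)\<^esub> y = \<one>\<^bsub>add_monoid (Zq q)\<^esub>"
    then have "0 \<le> z" "z < int q" "(y + z) mod int q = 0"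
      by (auto simp: residue_ring_def)
    then have "int q dvd z - (- y)"
      by (simp add: mod_eq_0_iff_dvd add.commute)
    then have "z mod int q = (- y) mod int q"
      by (simp add: mod_eq_dvd_iff)
    with \<open>0 \<le> z\<close> \<open>z < int q\<close> show "z = (- y) mod int q"
      by simp
  qed
  then show ?thesis
    by (simp add: a_minus_def residue_ring_def mod_simps)
qed

lemma Zq_add_pow: "[d] \<cdot>\<^bsub>Zq q\<^esub> x = (int d * x) mod int q"
proof (induction d)
  case 0
  then show ?case
    by (simp add: add_pow_def residue_ring_def nat_pow_def)
next
  case (Suc d)
  then show ?case
    by (simp add: add_pow_def residue_ring_def nat_pow_def mod_simps algebra_simps)
qed

end

theory Submission
  imports Defs "HOL-Library.Real_Mod"
begin

text \<open>
  Let \<open>q\<close> be the modulus. Suppose that the points \<open>(x, y)\<close> with \<open>x * y = D\<close> carry a probability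
  measure whose Fourier transform \<open>F\<close> is bounded below by a small multiple of
  \<open>- \<alpha> \<beta>\<close>. Expanding
  \<open>\<Sum> r\<^sub>A(x) r\<^sub>B(t y)\<close>, where \<open>r\<^sub>A\<close> and \<open>r\<^sub>B\<close> count representations as differences, over characters
  shows that \<open>t D\<close> lies in \<open>(A - A)(B - B)\<close> for every \<open>t\<close>; then \<open>d = gcd D q\<close> works.

  The measure is a product over the prime powers \<open>p ^ a\<close> dividing \<open>q\<close> exactly. At a large prime take
  \<open>(c, w / c)\<close> with \<open>c\<close> a random unit: the transform is a Kloosterman sum, which the fourth
  moment bounds by \<open>2 p powr (- 1/4)\<close>. At a small prime take \<open>(p ^ i * c, p ^ (b - i) * w / c)\<close> with
  \<open>i\<close> uniform in \<open>{0..b}\<close>: at most three values of \<open>i\<close> contribute a negative term, so the transform is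
  at least \<open>- 3 / (b + 1)\<close>. Since all factors are real and at most \<open>1\<close> in absolute value, a product of
  factors bounded below by \<open>- e\<close> is still bounded below by \<open>- e\<close>.

  With \<open>b\<close> of order \<open>\<beta> ^ (- 2)\<close>, only the primes up to order \<open>\<beta> ^ (- 2)\<close> may be called small.
  Between this and \<open>\<beta> ^ (- 8)\<close> the fourth moment bound alone is too weak; but the spectral mass of
  \<open>A\<close> is bounded, so only few such primes can do harm, and these are treated like small primes. They
  depend on \<open>A\<close> alone, hence \<open>D\<close> does not depend on \<open>t\<close>.
\<close>

section \<open>Additive characters and Kloosterman sums\<close>

definition unity_char :: "nat \<Rightarrow> int \<Rightarrow> complex"
  where "unity_char n k = cis (2 * pi * real_of_int k / real n)"

lemma unity_char_0 [simp]: "unity_char n 0 = 1"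
  by (simp add: unity_char_def)

lemma norm_unity_char [simp]: "norm (unity_char n k) = 1"
  by (simp add: unity_char_def)

lemma unity_char_add: "unity_char n (j + k) = unity_char n j * unity_char n k"
  by (simp add: unity_char_def cis_mult add_divide_distrib distrib_left)

lemma cnj_unity_char: "cnj (unity_char n k) = unity_char n (- k)"
  by (simp add: unity_char_def cis_cnj)

lemma unity_char_sum: "unity_char n (sum f A) = (\<Prod>x\<in>A. unity_char n (f x))"
  by (induction A rule: infinite_finite_induct) (auto simp: unity_char_add)

lemma unity_char_cancel:
  assumes "m > 0"
  shows "unity_char (n * m) (int m * k) = unity_char n k"
  using assms by (simp add: unity_char_def field_simps)

lemma unity_char_eq_1_iff:
  assumes "n > 0"
  shows "unity_char n k = 1 \<longleftrightarrow> int n dvd k"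
proof -
  have "unity_char n k = 1 \<longleftrightarrow> (\<exists>j. 2 * pi * real_of_int k / real n = real_of_int j * (2 * pi))"
    by (simp add: unity_char_def cis_eq_1_iff)
  also have "\<dots> \<longleftrightarrow> (\<exists>j. real_of_int k = real_of_int (int n * j))"
    using assms by (simp add: field_simps)
  also have "\<dots> \<longleftrightarrow> int n dvd k"
    by (simp only: of_int_eq_iff dvd_def)
  finally show ?thesis .
qed

lemma unity_char_cong:
  assumes "n > 0" "[j = k] (mod int n)"
  shows "unity_char n j = unity_char n k"
proof -
  have "unity_char n (j - k) = 1"
    using assms by (simp add: unity_char_eq_1_iff cong_iff_dvd_diff)
  then show ?thesis
    using unity_char_add[of n "j - k" k] by simp
qed

lemma sum_unity_char:
  assumes "n > 0"
  shows "(\<Sum>t\<in>{0..<int n}. unity_char n (t * k)) = (if int n dvd k then of_nat n else 0)"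
proof (cases "int n dvd k")
  case True
  then have "unity_char n (t * k) = 1" for t
    using assms by (simp add: unity_char_eq_1_iff)
  then show ?thesis
    using True by simp
next
  case False
  let ?f = "\<lambda>t::int. unity_char n (t * k)"
  \<comment> \<open>Multiplying by \<open>unity_char n k\<close> shifts the summation variable by
    one, which only permutes the residues. The sum is thus fixed by a factor different from
    1.\<close>
  have "(\<Sum>t\<in>{0..<int n}. ?f t) * unity_char n k = (\<Sum>t\<in>{0..<int n}. ?f (t + 1))"
    by (simp add: sum_distrib_right unity_char_add distrib_right)
  also have "\<dots> = (\<Sum>t\<in>{1..<int n + 1}. ?f t)"
    by (rule sum.reindex_bij_witness[of _ "\<lambda>t. t - 1" "\<lambda>t. t + 1"]) auto
  also have "{1..<int n + 1} = insert (int n) {1..<int n}"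
    using assms by auto
  also have "(\<Sum>t\<in>insert (int n) {1..<int n}. ?f t) = ?f (int n) + (\<Sum>t\<in>{1..<int n}. ?f t)"
    by simp
  also have "?f (int n) = ?f 0"
    using assms unity_char_eq_1_iff[of n "int n * k"] by simp
  also have "?f 0 + (\<Sum>t\<in>{1..<int n}. ?f t) = (\<Sum>t\<in>insert 0 {1..<int n}. ?f t)"
    by simp
  also have "insert 0 {1..<int n} = {0..<int n}"
    using assms by auto
  finally have "(\<Sum>t\<in>{0..<int n}. ?f t) * (unity_char n k - 1) = 0"
    by (simp add: algebra_simps)
  then show ?thesis
    using False assms by (simp add: unity_char_eq_1_iff)
qed

section \<open>Units paired with their inverses, and Kloosterman sums\<close>

text \<open>Carrying the inverse as a second component avoids an inverse function and makes the
  interchange of \<open>c\<close> and \<open>d\<close> a visible symmetry.\<close>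

definition unit_pairs :: "nat \<Rightarrow> (int \<times> int) set"
  where "unit_pairs n = {(c, d). c \<in> {0..<int n} \<and> d \<in> {0..<int n} \<and> [c * d = 1] (mod int n)}"

definition kloosterman :: "nat \<Rightarrow> int \<Rightarrow> int \<Rightarrow> complex"
  where "kloosterman n u v = (\<Sum>(c, d)\<in>unit_pairs n. unity_char n (u * c + v * d))"

lemma finite_unit_pairs [simp, intro]: "finite (unit_pairs n)"
  by (rule finite_subset[of _ "{0..<int n} \<times> {0..<int n}"]) (auto simp: unit_pairs_def)

lemma inverse_mod_cong_unique:
  fixes c d d' m :: int
  assumes "[c * d = 1] (mod m)" "[c' * d' = 1] (mod m)" "[c = c'] (mod m)"
  shows "[d = d'] (mod m)"
proof -
  have "[c * d' = 1] (mod m)"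
    using assms(2,3) by (metis cong_scalar_right cong_trans)
  then have "[d * (c * d') = d * 1] (mod m)"
    by (rule cong_scalar_left)
  moreover have "[d' * (c * d) = d' * 1] (mod m)"
    by (rule cong_scalar_left) (rule assms)
  ultimately show ?thesis
    by (metis cong_sym cong_trans mult.commute mult.left_commute mult.right_neutral)
qed

lemma unit_pairs_unique:
  assumes "(c, d) \<in> unit_pairs n" "(c, d') \<in> unit_pairs n"
  shows "d = d'"
proof -
  have "[d = d'] (mod int n)"
    using assms by (intro inverse_mod_cong_unique[of c d _ c]) (auto simp: unit_pairs_def)
  then show ?thesis
    using assms by (auto simp: unit_pairs_def intro: cong_less_imp_eq_int)
qed

lemma unit_pairs_ex:
  assumes "n > 0" "coprime c (int n)" "c \<in> {0..<int n}"
  shows "\<exists>d. (c, d) \<in> unit_pairs n"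
proof -
  obtain d where "[c * d = 1] (mod int n)"
    using cong_solve_coprime_int[OF assms(2)] by auto
  then have "[c * (d mod int n) = 1] (mod int n)"
    by (simp add: cong_def mod_simps)
  then show ?thesis
    using assms by (intro exI[of _ "d mod int n"]) (auto simp: unit_pairs_def)
qed

lemma unit_pairs_coprime:
  assumes "(c, d) \<in> unit_pairs n"
  shows "coprime c (int n)" "coprime d (int n)"
proof -
  have "[c * d = 1] (mod int n)" "[d * c = 1] (mod int n)"
    using assms by (auto simp: unit_pairs_def mult.commute)
  then show "coprime c (int n)" "coprime d (int n)"
    using coprime_iff_invertible_int by blast+
qed

text \<open>As \<open>r\<close> and \<open>s\<close> are mutually inverse, multiplying
  \<open>c\<close> by \<open>r\<close> and \<open>d\<close> by \<open>s\<close> permutes the unit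
  pairs.\<close>

lemma kloosterman_scale:
  assumes "n > 0" "[r * s = 1] (mod int n)"
  shows "kloosterman n (u * r) (v * s) = kloosterman n u v"
proof -
  let ?N = "int n"
  define F where "F r s = (\<lambda>(c::int, d::int). (r * c mod ?N, s * d mod ?N))" for r s
  have maps: "F r s h \<in> unit_pairs n" if "[r * s = 1] (mod ?N)" "h \<in> unit_pairs n" for r s h
  proof -
    obtain c d where h: "h = (c, d)" "[c * d = 1] (mod ?N)"
      using \<open>h \<in> unit_pairs n\<close> by (auto simp: unit_pairs_def)
    have "[(r * s) * (c * d) = 1 * 1] (mod ?N)"
      using that h by (intro cong_mult)
    then have "[(r * c mod ?N) * (s * d mod ?N) = 1] (mod ?N)"
      by (simp add: cong_def mod_mult_eq mult_ac)
    then show ?thesis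
      using assms h by (auto simp: F_def unit_pairs_def)
  qed
  have inv: "F s r (F r s h) = h" if rs: "[r * s = 1] (mod ?N)" and "h \<in> unit_pairs n" for r s h
  proof -
    obtain c d where h: "h = (c, d)" "c \<in> {0..<?N}" "d \<in> {0..<?N}"
      using \<open>h \<in> unit_pairs n\<close> by (auto simp: unit_pairs_def)
    have "[(r * s) * c = 1 * c] (mod ?N)" "[(r * s) * d = 1 * d] (mod ?N)"
      using rs by (intro cong_mult cong_refl; simp)+
    then show ?thesis
      using h by (auto simp: F_def mod_simps cong_def algebra_simps)
  qed
  have sr: "[s * r = 1] (mod ?N)"
    using assms by (simp add: mult.commute)
  have "kloosterman n (u * r) (v * s) = (\<Sum>h\<in>unit_pairs n. (\<lambda>(c,d). unity_char n (u * c + v * d)) (F r s h))"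
    unfolding kloosterman_def
  proof (rule sum.cong)
    fix h assume "h \<in> unit_pairs n"
    obtain c d where h: "h = (c, d)" by force
    have "[u * r * c + v * s * d = u * (r * c mod ?N) + v * (s * d mod ?N)] (mod ?N)"
      unfolding mult.assoc by (intro cong_add cong_scalar_left) (simp_all add: cong_def)
    then show "(case h of (c, d) \<Rightarrow> unity_char n (u * r * c + v * s * d)) =
        (\<lambda>(c,d). unity_char n (u * c + v * d)) (F r s h)"
      unfolding h F_def using assms(1) by (simp add: unity_char_cong)
  qed simp
  also have "\<dots> = (\<Sum>h\<in>unit_pairs n. (\<lambda>(c,d). unity_char n (u * c + v * d)) h)"
    by (rule sum.reindex_bij_witness[of _ "F s r" "F r s"])
      (use maps inv assms(2) sr in auto)
  finally show ?thesis
    by (simp add: kloosterman_def)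
qed

text \<open>Scaling by \<open>r = s = -1\<close> fixes the sum and also conjugates it.\<close>

lemma kloosterman_real: "n > 0 \<Longrightarrow> kloosterman n u v \<in> \<real>"
proof -
  assume "n > 0"
  then have "kloosterman n (u * (-1)) (v * (-1)) = kloosterman n u v"
    by (intro kloosterman_scale) auto
  moreover have "kloosterman n (u * (-1)) (v * (-1)) = cnj (kloosterman n u v)"
    by (simp add: kloosterman_def cnj_unity_char case_prod_unfold algebra_simps)
  ultimately show ?thesis
    by (metis Reals_cnj_iff)
qed

lemma kloosterman_swap: "kloosterman n u v = kloosterman n v u"
  unfolding kloosterman_def
  by (rule sum.reindex_bij_witness[of _ "\<lambda>(c, d). (d, c)" "\<lambda>(c, d). (d, c)"])
    (auto simp: unit_pairs_def algebra_simps)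

lemma norm_kloosterman_le: "norm (kloosterman n u v) \<le> card (unit_pairs n)"
  unfolding kloosterman_def by (rule order_trans[OF norm_sum]) (simp add: case_prod_unfold)

lemma kloosterman_trivial:
  assumes "n > 0" "int n dvd u" "int n dvd v"
  shows "kloosterman n u v = card (unit_pairs n)"
proof -
  have "unity_char n (u * c + v * d) = 1" for c d
    using assms by (simp add: unity_char_eq_1_iff)
  then show ?thesis
    by (simp add: kloosterman_def case_prod_unfold)
qed

section \<open>Kloosterman sums modulo higher prime powers\<close>

text \<open>Substituting \<open>c (1 + p ^ (s - 1) t)\<close> for \<open>c\<close> and averaging over \<open>t\<close> modulo \<open>p\<close>.\<close>

lemma kloosterman_restrict:
  assumes p: "prime p" and s: "2 \<le> s" "s \<le> a"
  defines "n \<equiv> p ^ a"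
  shows "kloosterman n (int p ^ (a - s) * u) (int p ^ (a - s) * v) =
    (\<Sum>(c, d)\<in>{(c, d). (c, d) \<in> unit_pairs n \<and> int p dvd u * c - v * d}.
      unity_char n (int p ^ (a - s) * u * c + int p ^ (a - s) * v * d))"
    (is "?K = (\<Sum>(c, d)\<in>?G. ?e c d)")
proof -
  define h where "h = int p ^ (s - 1)"
  define U where "U = int p ^ (a - s) * u"
  define V where "V = int p ^ (a - s) * v"
  have p0: "p > 0" and n0: "n > 0"
    using p by (auto simp: n_def prime_gt_0_nat)
  have ph: "int p dvd h"
    using s by (auto simp: h_def intro: dvd_power)
  have ps: "int p ^ (a - s) * int p ^ s = int n"
    using s by (simp add: n_def flip: power_add)
  have psh: "int p ^ (a - s) * h = int p ^ (a - 1)"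
    using s by (simp add: h_def flip: power_add)
  \<comment> \<open>From \<open>s \<ge> 2\<close> follows \<open>2 * (s - 1) \<ge> s\<close>. Hence
    \<open>1 - h * t\<close> is an inverse of \<open>1 + h * t\<close> modulo
    \<open>p ^ s\<close>.\<close>
  have ps1: "int p ^ s dvd h * h"
    using s by (auto simp: h_def intro!: le_imp_power_dvd simp flip: power_add)
  have shift: "kloosterman n U V = (\<Sum>(c, d)\<in>unit_pairs n. ?e c d * unity_char p (t * (u * c - v * d)))" for t
  proof -
    have "coprime (1 + h * t) (int p)"
      using ph by (intro coprimeI) (meson dvd_add_left_iff dvd_mult2 dvd_trans)
    then have "coprime (1 + h * t) (int n)"
      by (simp add: n_def)
    then obtain r where r: "[(1 + h * t) * r = 1] (mod int n)"
      using cong_solve_coprime_int by blast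
    have rs: "[r = 1 - h * t] (mod int p ^ s)"
    proof -
      have "int p ^ s dvd int n"
        using s by (simp add: n_def le_imp_power_dvd)
      then have "int p ^ s dvd (1 + h * t) * r - 1"
        using r by (meson cong_iff_dvd_diff dvd_trans)
      then have "int p ^ s dvd ((1 + h * t) * r - 1) * (1 - h * t) + h * h * (t * t * r)"
        using ps1 by (meson dvd_add dvd_mult2)
      also have "((1 + h * t) * r - 1) * (1 - h * t) + h * h * (t * t * r) = r - (1 - h * t)"
        by (simp add: algebra_simps)
      finally show ?thesis
        by (simp add: cong_iff_dvd_diff)
    qed
    have eq: "unity_char n (U * (1 + h * t) * c + V * r * d) = ?e c d * unity_char p (t * (u * c - v * d))" for c d
    proof -
      \<comment> \<open>The inverse is known only modulo \<open>p ^ s\<close>; the factor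
        \<open>p ^ (a - s)\<close> of \<open>V\<close> lifts this to modulus
        \<open>n\<close>.\<close>
      have "[V * r = V * (1 - h * t)] (mod int n)"
      proof -
        have "int p ^ (a - s) * int p ^ s dvd int p ^ (a - s) * (r - (1 - h * t))"
          using rs by (intro mult_dvd_mono) (auto simp: cong_iff_dvd_diff)
        then have "int n dvd int p ^ (a - s) * (r - (1 - h * t)) * v"
          unfolding ps by (rule dvd_mult2)
        then show ?thesis
          by (simp add: cong_iff_dvd_diff V_def algebra_simps)
      qed
      then have "[U * (1 + h * t) * c + V * r * d = U * (1 + h * t) * c + V * (1 - h * t) * d] (mod int n)"
        by (intro cong_add cong_scalar_right) auto
      also have "U * (1 + h * t) * c + V * (1 - h * t) * d =
          (U * c + V * d) + (int p ^ (a - s) * h) * (t * (u * c - v * d))"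
        by (simp add: U_def V_def algebra_simps)
      finally have "unity_char n (U * (1 + h * t) * c + V * r * d) =
          unity_char n (U * c + V * d) * unity_char n (int p ^ (a - 1) * (t * (u * c - v * d)))"
        using n0 by (simp add: unity_char_cong psh flip: unity_char_add)
      also have "unity_char n (int p ^ (a - 1) * (t * (u * c - v * d))) = unity_char p (t * (u * c - v * d))"
      proof -
        have "n = p * p ^ (a - 1)"
          using s by (simp add: n_def flip: power_Suc)
        then show ?thesis
          using unity_char_cancel[of "p ^ (a - 1)" p "t * (u * c - v * d)"] p0 by simp
      qed
      finally show ?thesis
        by (simp add: U_def V_def)
    qed
    have "kloosterman n U V = kloosterman n (U * (1 + h * t)) (V * r)"
      using kloosterman_scale[OF n0 r] by simp
    also have "\<dots> = (\<Sum>(c, d)\<in>unit_pairs n. ?e c d * unity_char p (t * (u * c - v * d)))"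
      unfolding kloosterman_def eq ..
    finally show ?thesis .
  qed
  have "of_nat p * kloosterman n U V = (\<Sum>t\<in>{0..<int p}. kloosterman n U V)"
    by simp
  also have "\<dots> = (\<Sum>t\<in>{0..<int p}. \<Sum>(c, d)\<in>unit_pairs n. ?e c d * unity_char p (t * (u * c - v * d)))"
    using shift by simp
  also have "\<dots> = (\<Sum>h\<in>unit_pairs n. \<Sum>t\<in>{0..<int p}.
      ?e (fst h) (snd h) * unity_char p (t * (u * fst h - v * snd h)))"
    by (subst sum.swap) (simp add: case_prod_unfold)
  also have "\<dots> = (\<Sum>h\<in>unit_pairs n. of_nat p *
      (if int p dvd u * fst h - v * snd h then ?e (fst h) (snd h) else 0))"
    using p0 by (intro sum.cong) (auto simp: sum_unity_char simp flip: sum_distrib_left)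
  also have "\<dots> = of_nat p * (\<Sum>h\<in>unit_pairs n.
      (if int p dvd u * fst h - v * snd h then ?e (fst h) (snd h) else 0))"
    by (simp add: sum_distrib_left)
  also have "(\<Sum>h\<in>unit_pairs n.
      (if int p dvd u * fst h - v * snd h then ?e (fst h) (snd h) else 0)) = (\<Sum>(c, d)\<in>?G. ?e c d)"
    by (simp add: sum.inter_filter[symmetric] case_prod_unfold)
  finally show ?thesis
    using p0 by (simp add: U_def V_def)
qed

text \<open>A surviving pair would satisfy \<open>u * c = v * d\<close> modulo \<open>p\<close> with
  units \<open>c\<close> and \<open>d\<close>, which is impossible when \<open>p\<close> divides
  exactly one of \<open>u\<close> and \<open>v\<close>.\<close>

lemma kloosterman_eq_0:
  assumes p: "prime p" and s: "2 \<le> s" "s \<le> a"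
    and uv: "int p dvd u \<longleftrightarrow> \<not> int p dvd v"
  shows "kloosterman (p ^ a) (int p ^ (a - s) * u) (int p ^ (a - s) * v) = 0"
proof -
  have "{(c, d). (c, d) \<in> unit_pairs (p ^ a) \<and> int p dvd u * c - v * d} = {}"
  proof -
    have False if "(c, d) \<in> unit_pairs (p ^ a)" "int p dvd u * c - v * d" for c d
    proof -
      have "coprime c (int p)" "coprime d (int p)"
        using unit_pairs_coprime[OF that(1)] s by auto
      then have "\<not> int p dvd c" "\<not> int p dvd d"
        using p by (metis coprime_absorb_right not_prime_unit prime_nat_int_transfer)+
      moreover have "int p dvd u * c \<longleftrightarrow> int p dvd v * d"
        using that(2) by (metis dvd_add_right_iff diff_add_cancel dvd_diff)
      ultimately show False
        using p uv by (simp add: prime_dvd_mult_iff)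
    qed
    then show ?thesis
      by auto
  qed
  then show ?thesis
    unfolding kloosterman_restrict[OF p s] by (simp only: sum.empty)
qed

lemma div_mod_eqI:
  fixes c c' m :: int
  assumes "c div m = c' div m" "c mod m = c' mod m"
  shows "c = c'"
proof -
  have "c = c div m * m + c mod m"
    by (rule div_mult_mod_eq[symmetric])
  also have "\<dots> = c' div m * m + c' mod m"
    by (simp only: assms)
  also have "\<dots> = c'"
    by (rule div_mult_mod_eq)
  finally show ?thesis .
qed

lemma int_div_less:
  fixes c m k :: int
  assumes "m > 0" "c < m * k"
  shows "c div m < k"
proof -
  have "m * (c div m) \<le> c"
    using assms(1) by (simp add: minus_mod_eq_mult_div[symmetric])
  then have "m * (c div m) < m * k"
    using assms(2) by linarith
  then show ?thesis
    using assms(1) by simp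
qed

text \<open>Since \<open>d\<close> inverts \<open>c\<close>, the condition says that
  \<open>u * c * c = v\<close> modulo \<open>p\<close>. So \<open>c\<close> has at most two residues
  modulo \<open>p\<close>, negatives of each other; each has \<open>p ^ (a - 1)\<close> lifts, and
  \<open>c\<close> determines \<open>d\<close>.\<close>

lemma card_sqrt_pairs_le:
  assumes p: "prime p" and a: "a \<ge> 1" and u: "\<not> int p dvd u"
  shows "card {(c, d). (c, d) \<in> unit_pairs (p ^ a) \<and> int p dvd u * c - v * d} \<le> 2 * p ^ (a - 1)"
    (is "card ?G \<le> _")
proof (cases "?G = {}")
  case True
  show ?thesis unfolding True by simp
next
  case False
  then obtain c0 d0 where c0: "(c0, d0) \<in> ?G" by auto
  have p': "prime (int p)" and p0: "int p > 0" "p > 0"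
    using p by (auto simp: prime_gt_0_nat)
  have sq: "int p dvd u * c * c - v" if "(c, d) \<in> ?G" for c d
  proof -
    have "[c * d = 1] (mod int p ^ a)"
      using that by (auto simp: unit_pairs_def)
    moreover have "int p dvd int p ^ a"
      using a by (intro dvd_power) auto
    ultimately have "int p dvd c * d - 1"
      by (meson cong_iff_dvd_diff dvd_trans)
    moreover have "int p dvd u * c - v * d"
      using that by auto
    ultimately have "int p dvd (u * c - v * d) * c + (c * d - 1) * v"
      by (meson dvd_add dvd_mult2)
    then show ?thesis
      by (simp add: algebra_simps)
  qed
  define R where "R = {c0 mod int p, (- c0) mod int p}"
  have "card ?G \<le> card (R \<times> {0..<int p ^ (a - 1)})"
  proof (rule card_inj_on_le)
    show "inj_on (\<lambda>(c, d). (c mod int p, c div int p)) ?G"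
    proof (rule inj_onI)
      fix g g' assume *: "g \<in> ?G" "g' \<in> ?G"
        "(\<lambda>(c, d). (c mod int p, c div int p)) g = (\<lambda>(c, d). (c mod int p, c div int p)) g'"
      obtain c d c' d' where g: "g = (c, d)" "g' = (c', d')"
        by (metis surj_pair)
      have "c = c'"
        using *(3) by (intro div_mod_eqI[of c "int p"]) (simp_all add: g)
      then show "g = g'"
        using *(1,2) g unit_pairs_unique[of c d "p ^ a" d'] by auto
    qed
    show "(\<lambda>(c, d). (c mod int p, c div int p)) ` ?G \<subseteq> R \<times> {0..<int p ^ (a - 1)}"
    proof clarify
      fix c d assume cd: "(c, d) \<in> unit_pairs (p ^ a)" "int p dvd u * c - v * d"
      have "int p dvd (u * c * c - v) - (u * c0 * c0 - v)"
        by (rule dvd_diff[OF sq[of c d] sq[of c0 d0]]) (use cd c0 in auto)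
      then have "int p dvd u * ((c - c0) * (c - (- c0)))"
        by (simp add: algebra_simps)
      then have "int p dvd c - c0 \<or> int p dvd c - (- c0)"
        using u p' by (metis prime_dvd_multD)
      then have "c mod int p \<in> R"
        by (auto simp: R_def mod_eq_dvd_iff)
      moreover have "c div int p < int p ^ (a - 1)"
      proof -
        have "c < int p * int p ^ (a - 1)"
          using cd(1) a by (auto simp: unit_pairs_def simp flip: power_Suc)
        then show ?thesis
          using p0 by (intro int_div_less)
      qed
      moreover have "c div int p \<ge> 0"
        using cd(1) p0 by (auto simp: unit_pairs_def pos_imp_zdiv_nonneg_iff)
      ultimately show "c mod int p \<in> R \<and> c div int p \<in> {0..<int p ^ (a - 1)}"
        by auto
    qed
    show "finite (R \<times> {0..<int p ^ (a - 1)})"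
      by (simp add: R_def)
  qed
  also have "\<dots> = card R * p ^ (a - 1)"
    by (simp add: card_cartesian_product nat_power_eq)
  also have "\<dots> \<le> 2 * p ^ (a - 1)"
    by (intro mult_right_mono) (auto simp: R_def card_insert_if)
  finally show ?thesis .
qed

lemma norm_kloosterman_higher:
  assumes p: "prime p" and s: "2 \<le> s" "s \<le> a" and u: "\<not> int p dvd u"
  shows "norm (kloosterman (p ^ a) (int p ^ (a - s) * u) (int p ^ (a - s) * v)) \<le> 2 * p ^ (a - 1)"
proof -
  let ?G = "{(c, d). (c, d) \<in> unit_pairs (p ^ a) \<and> int p dvd u * c - v * d}"
  have "norm (kloosterman (p ^ a) (int p ^ (a - s) * u) (int p ^ (a - s) * v)) \<le> card ?G"
    unfolding kloosterman_restrict[OF p s]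
    by (rule order_trans[OF norm_sum]) (simp add: case_prod_unfold)
  also have "\<dots> \<le> real (2 * p ^ (a - 1))"
    using card_sqrt_pairs_le[OF p _ u, of a v] s by (simp only: of_nat_le_iff)
  finally show ?thesis
    by simp
qed

section \<open>Reduction to prime moduli and the number of units\<close>

text \<open>Every lift of a unit modulo \<open>p\<close> is a unit modulo \<open>p ^ a\<close>, so
  the quotient \<open>c div p\<close> is free and \<open>d\<close> is then forced. This serves both
  to reduce Kloosterman sums and to count units.\<close>

lemma bij_betw_unit_pairs:
  assumes p: "prime p" and a: "a \<ge> 1"
  shows "bij_betw (\<lambda>(c, d). ((c mod int p, d mod int p), c div int p))
    (unit_pairs (p ^ a)) (unit_pairs p \<times> {0..<int p ^ (a - 1)})"
proof -
  have p0: "int p > 0" "p > 0"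
    using p by (auto simp: prime_gt_0_nat)
  have dvd: "int p dvd int p ^ a"
    using a by (intro dvd_power) auto
  let ?f = "\<lambda>(c, d). ((c mod int p, d mod int p), c div int p)"
  have "inj_on ?f (unit_pairs (p ^ a))"
  proof (rule inj_onI)
    fix g g' assume *: "g \<in> unit_pairs (p ^ a)" "g' \<in> unit_pairs (p ^ a)" "?f g = ?f g'"
    obtain c d c' d' where g: "g = (c, d)" "g' = (c', d')"
      by (metis surj_pair)
    have "c = c'"
      using *(3) by (intro div_mod_eqI[of c "int p"]) (simp_all add: g)
    then show "g = g'"
      using *(1,2) g unit_pairs_unique[of c d "p ^ a" d'] by auto
  qed
  moreover have "?f ` unit_pairs (p ^ a) = unit_pairs p \<times> {0..<int p ^ (a - 1)}"
  proof (intro equalityI subsetI)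
    fix y assume "y \<in> ?f ` unit_pairs (p ^ a)"
    then obtain c d where cd: "(c, d) \<in> unit_pairs (p ^ a)"
      and y: "y = ((c mod int p, d mod int p), c div int p)" by auto
    have "[c * d = 1] (mod int p)"
      using cd dvd by (auto simp: unit_pairs_def intro: cong_dvd_modulus)
    then have "[(c mod int p) * (d mod int p) = 1] (mod int p)"
      by (simp add: cong_def mod_mult_eq)
    then have "(c mod int p, d mod int p) \<in> unit_pairs p"
      using p0 by (simp add: unit_pairs_def)
    moreover have "c div int p < int p ^ (a - 1)"
    proof -
      have "c < int p * int p ^ (a - 1)"
        using cd a by (auto simp: unit_pairs_def simp flip: power_Suc)
      then show ?thesis
        using p0 by (intro int_div_less)
    qed
    moreover have "c div int p \<ge> 0"
      using cd p0 by (auto simp: unit_pairs_def pos_imp_zdiv_nonneg_iff)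
    ultimately show "y \<in> unit_pairs p \<times> {0..<int p ^ (a - 1)}"
      using y by auto
  next
    fix y assume "y \<in> unit_pairs p \<times> {0..<int p ^ (a - 1)}"
    then obtain c0 d0 k where y: "y = ((c0, d0), k)" and cd0: "(c0, d0) \<in> unit_pairs p"
      and k: "0 \<le> k" "k < int p ^ (a - 1)" by auto
    define c where "c = c0 + int p * k"
    have c0: "0 \<le> c0" "c0 < int p" "0 \<le> d0" "d0 < int p"
      using cd0 by (auto simp: unit_pairs_def)
    have "coprime c0 (int p)"
      using unit_pairs_coprime[OF cd0] by simp
    then have "coprime c (int p)"
      unfolding c_def
      by (intro coprimeI) (meson coprime_common_divisor dvd_add_left_iff dvd_mult2)
    then have cop: "coprime c (int (p ^ a))"
      by simp
    have "c < int p * 1 + int p * k"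
      using c0 by (simp add: c_def)
    also have "\<dots> = int p * (1 + k)"
      by (simp add: algebra_simps)
    also have "\<dots> \<le> int p * int p ^ (a - 1)"
      using k p0 by (intro mult_left_mono) auto
    also have "\<dots> = int (p ^ a)"
      using a by (simp flip: power_Suc)
    finally have "c \<in> {0..<int (p ^ a)}"
      using k c0 by (simp add: c_def)
    then obtain d where d: "(c, d) \<in> unit_pairs (p ^ a)"
      using unit_pairs_ex[of "p ^ a" c] cop p0 by auto
    have c_mod: "c mod int p = c0" "c div int p = k"
      using c0 p0 by (auto simp: c_def)
    have "[d = d0] (mod int p)"
    proof (rule inverse_mod_cong_unique)
      show "[c * d = 1] (mod int p)"
        using d dvd by (auto simp: unit_pairs_def intro: cong_dvd_modulus)
      show "[c0 * d0 = 1] (mod int p)"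
        using cd0 by (auto simp: unit_pairs_def)
      show "[c = c0] (mod int p)"
        by (simp add: c_def cong_def)
    qed
    then have "d mod int p = d0"
      using c0 by (simp add: cong_def)
    then have "?f (c, d) = y"
      using y c_mod by simp
    then show "y \<in> ?f ` unit_pairs (p ^ a)"
      using d by (intro image_eqI[of y ?f "(c, d)"]) simp_all
  qed
  ultimately show ?thesis
    by (simp add: bij_betw_def)
qed

text \<open>The character sees only residues modulo \<open>p\<close>, and each unit pair modulo
  \<open>p\<close> has \<open>p ^ (a - 1)\<close> lifts.\<close>

lemma kloosterman_reduce:
  assumes p: "prime p" and a: "a \<ge> 1"
  shows "kloosterman (p ^ a) (int p ^ (a - 1) * u) (int p ^ (a - 1) * v) = of_nat (p ^ (a - 1)) * kloosterman p u v"
proof -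
  have p0: "p > 0"
    using p by (simp add: prime_gt_0_nat)
  let ?F = "\<lambda>((c, d), k::int). unity_char p (u * c + v * d)"
  have "kloosterman (p ^ a) (int p ^ (a - 1) * u) (int p ^ (a - 1) * v) =
      (\<Sum>h\<in>unit_pairs (p ^ a). ?F ((\<lambda>(c, d). ((c mod int p, d mod int p), c div int p)) h))"
    unfolding kloosterman_def
  proof (rule sum.cong[OF refl])
    fix h :: "int \<times> int"
    obtain c d where h: "h = (c, d)" by force
    have "unity_char (p ^ a) (int p ^ (a - 1) * u * c + int p ^ (a - 1) * v * d) =
        unity_char (p * p ^ (a - 1)) (int (p ^ (a - 1)) * (u * c + v * d))"
      using a by (simp add: algebra_simps flip: power_Suc)
    also have "\<dots> = unity_char p (u * c + v * d)"
      using p0 by (intro unity_char_cancel) simp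
    also have "\<dots> = unity_char p (u * (c mod int p) + v * (d mod int p))"
      using p0 by (intro unity_char_cong cong_add cong_scalar_left) (simp_all add: cong_def)
    finally show "(case h of (c, d) \<Rightarrow> unity_char (p ^ a) (int p ^ (a - 1) * u * c + int p ^ (a - 1) * v * d)) =
        ?F ((\<lambda>(c, d). ((c mod int p, d mod int p), c div int p)) h)"
      by (simp add: h)
  qed
  also have "\<dots> = sum ?F (unit_pairs p \<times> {0..<int p ^ (a - 1)})"
    by (rule sum.reindex_bij_betw[OF bij_betw_unit_pairs[OF p a]])
  also have "\<dots> = (\<Sum>h\<in>unit_pairs p. \<Sum>k\<in>{0..<int p ^ (a - 1)}. ?F (h, k))"
    by (subst sum.cartesian_product) (simp add: case_prod_unfold)
  also have "\<dots> = of_nat (p ^ (a - 1)) * kloosterman p u v"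
    by (simp add: kloosterman_def case_prod_unfold sum_distrib_left nat_power_eq)
  finally show ?thesis .
qed

lemma bij_betw_fst_unit_pairs_prime:
  assumes p: "prime p"
  shows "bij_betw fst (unit_pairs p) {1..<int p}"
proof -
  have p0: "p > 1"
    using p by (rule prime_gt_1_nat)
  have "inj_on fst (unit_pairs p)"
    using unit_pairs_unique by (auto simp: inj_on_def)
  moreover have "fst ` unit_pairs p = {1..<int p}"
  proof (intro equalityI subsetI)
    fix c assume "c \<in> fst ` unit_pairs p"
    then obtain d where d: "(c, d) \<in> unit_pairs p" by auto
    then have "coprime c (int p)" "0 \<le> c" "c < int p"
      using unit_pairs_coprime[OF d] by (auto simp: unit_pairs_def)
    moreover have "c \<noteq> 0"
      using \<open>coprime c (int p)\<close> p0 by auto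
    ultimately show "c \<in> {1..<int p}" by auto
  next
    fix c assume c: "c \<in> {1..<int p}"
    then have "\<not> int p dvd c"
      by (auto dest: zdvd_imp_le)
    then have "coprime c (int p)"
      using p prime_imp_coprime[of "int p" c] by (simp add: coprime_commute)
    then show "c \<in> fst ` unit_pairs p"
      using unit_pairs_ex[of p c] c p0 by force
  qed
  ultimately show ?thesis
    by (simp add: bij_betw_def)
qed

lemma card_unit_pairs_prime: "prime p \<Longrightarrow> card (unit_pairs p) = p - 1"
  using bij_betw_same_card[OF bij_betw_fst_unit_pairs_prime[of p]] by simp

lemma card_unit_pairs:
  assumes "prime p" "a \<ge> 1"
  shows "card (unit_pairs (p ^ a)) = p ^ (a - 1) * (p - 1)"
  using bij_betw_same_card[OF bij_betw_unit_pairs[OF assms]] assms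
  by (simp add: card_cartesian_product card_unit_pairs_prime nat_power_eq)

text \<open>This is a Ramanujan sum: the complete character sum vanishes, and the term at
  \<open>c = 0\<close> is missing.\<close>

lemma kloosterman_prime_right_0:
  assumes p: "prime p" and u: "\<not> int p dvd u" and v: "int p dvd v"
  shows "kloosterman p u v = -1"
proof -
  have p0: "p > 0"
    using p by (simp add: prime_gt_0_nat)
  have "kloosterman p u v = (\<Sum>h\<in>unit_pairs p. unity_char p (fst h * u))"
    unfolding kloosterman_def using p0 v
    by (intro sum.cong) (auto intro!: unity_char_cong simp: cong_iff_dvd_diff algebra_simps)
  also have "\<dots> = (\<Sum>c\<in>{1..<int p}. unity_char p (c * u))"
    by (rule sum.reindex_bij_betw[OF bij_betw_fst_unit_pairs_prime[OF p]])
  also have "\<dots> = (\<Sum>c\<in>{0..<int p}. unity_char p (c * u)) - 1"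
  proof -
    have "{0..<int p} = insert 0 {1..<int p}"
      using p0 by auto
    then show ?thesis by simp
  qed
  also have "\<dots> = -1"
    using sum_unity_char[OF p0, of u] u by simp
  finally show ?thesis .
qed

section \<open>The fourth moment of Kloosterman sums\<close>

text \<open>Orthogonality turns the fourth moment into a count of these quadruples. They are nested
  as pairs of pairs because the fourth power is expanded as the square of a square.\<close>

definition null_quads :: "nat \<Rightarrow> (((int \<times> int) \<times> (int \<times> int)) \<times> (int \<times> int) \<times> (int \<times> int)) set"
  where "null_quads p = {((h1, h2), (h3, h4)). h1 \<in> unit_pairs p \<and> h2 \<in> unit_pairs p \<and>
     h3 \<in> unit_pairs p \<and> h4 \<in> unit_pairs p \<and>
     int p dvd fst h1 + fst h2 + fst h3 + fst h4 \<and> int p dvd snd h1 + snd h2 + snd h3 + snd h4}"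

lemma unit_pairs_neg_unique:
  assumes "(c, d) \<in> unit_pairs n" "(c', d') \<in> unit_pairs n" "(e, f) \<in> unit_pairs n"
    and "int n dvd c + e" "int n dvd c' + e"
  shows "(c, d) = (c', d')"
proof -
  have "int n dvd (c + e) - (c' + e)"
    using assms by (intro dvd_diff)
  then have "[c = c'] (mod int n)"
    by (simp add: cong_iff_dvd_diff)
  then have "c = c'"
    using assms by (auto simp: unit_pairs_def intro: cong_less_imp_eq_int)
  then show ?thesis
    using assms unit_pairs_unique by auto
qed

text \<open>With e1, e2, e3 the elementary symmetric functions of \<open>c1\<close>,
  \<open>c2\<close>, \<open>c3\<close>, the product \<open>(c1 + c2) * (c1 + c3) * (c2 + c3)\<close>
  is e1 e2 - e3. Modulo \<open>p\<close>, e1 is \<open>- c4\<close> and e2 = e3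
  \<open>(d1 + d2 + d3)\<close> = - e3 \<open>d4\<close>, so the product vanishes and one of its
  factors does.\<close>

lemma null_quads_cases:
  assumes p: "prime p"
    and h: "(c1, d1) \<in> unit_pairs p" "(c2, d2) \<in> unit_pairs p"
      "(c3, d3) \<in> unit_pairs p" "(c4, d4) \<in> unit_pairs p"
    and c: "int p dvd c1 + c2 + c3 + c4" and d: "int p dvd d1 + d2 + d3 + d4"
  shows "int p dvd c1 + c2 \<and> int p dvd c3 + c4 \<or> int p dvd c1 + c3 \<and> int p dvd c2 + c4 \<or>
    int p dvd c2 + c3 \<and> int p dvd c1 + c4"
proof -
  define P where "P = int p"
  have P: "prime P"
    using p by (simp add: P_def)
  have cd: "P dvd c1 * d1 - 1" "P dvd c2 * d2 - 1" "P dvd c3 * d3 - 1" "P dvd c4 * d4 - 1"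
    using h by (auto simp: unit_pairs_def P_def cong_iff_dvd_diff)
  obtain k1 k2 k3 k4 where k: "c1 * d1 = 1 + P * k1" "c2 * d2 = 1 + P * k2"
      "c3 * d3 = 1 + P * k3" "c4 * d4 = 1 + P * k4"
    using cd unfolding dvd_def by (metis add.commute diff_add_cancel)
  obtain m m' where m: "c1 + c2 + c3 + c4 = P * m" "d1 + d2 + d3 + d4 = P * m'"
    using c d unfolding dvd_def P_def by blast
  have "\<exists>z. (c1 + c2) * (c1 + c3) * (c2 + c3) = P * z"
  proof -
    have eq: "(c1 + c2) * (c1 + c3) * (c2 + c3) =
       (c1 + c2 + c3) * (c1 * c2 + c1 * c3 + c2 * c3) - c1 * c2 * c3"
      by (simp add: algebra_simps)
    have "\<exists>z. (c1 + c2 + c3) * (c1 * c2 + c1 * c3 + c2 * c3) - c1 * c2 * c3 = P * z"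
    proof -
      have c4: "c1 + c2 + c3 = P * m - c4" and d4: "d4 = P * m' - (d1 + d2 + d3)"
        using m by auto
      \<comment> \<open>\<open>Q\<close> and \<open>E\<close> are the third and second elementary
        symmetric functions, \<open>S\<close> the sum of the inverses. Congruences are kept as
        equations with explicit multiples of \<open>P\<close>; \<open>K\<close> collects those in
        \<open>Q * S\<close>.\<close>
      define S where "S = d1 + d2 + d3"
      define Q where "Q = c1 * c2 * c3"
      define E where "E = c1 * c2 + c1 * c3 + c2 * c3"
      define K where "K = k1 * c2 * c3 + k2 * c1 * c3 + k3 * c1 * c2"
      have "Q * S = c2 * c3 * (c1 * d1) + c1 * c3 * (c2 * d2) + c1 * c2 * (c3 * d3)"
        by (simp add: Q_def S_def algebra_simps)
      also have "\<dots> = E + P * K"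
        unfolding k by (simp add: E_def K_def algebra_simps)
      finally have QS: "Q * S = E + P * K" .
      have "c4 * (P * m' - S) = 1 + P * k4"
        using k(4) d4 by (simp add: S_def)
      then have c4S: "c4 * S = c4 * (P * m') - 1 - P * k4"
        by (simp add: algebra_simps)
      have "c4 * E = Q * (c4 * S) - c4 * (P * K)"
        using arg_cong[OF QS, of "\<lambda>x. c4 * x"] by (simp add: algebra_simps)
      also have "\<dots> = Q * (c4 * (P * m') - 1 - P * k4) - c4 * (P * K)"
        unfolding c4S ..
      finally have "(P * m - c4) * E - Q = P * (m * E + Q * k4 - Q * c4 * m' + c4 * K)"
        by (simp add: algebra_simps)
      then show ?thesis
        unfolding c4 E_def Q_def by blast
    qed
    then show ?thesis
      by (simp only: eq)
  qed
  then have "P dvd (c1 + c2) * (c1 + c3) * (c2 + c3)"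
    by auto
  then have "P dvd c1 + c2 \<or> P dvd c1 + c3 \<or> P dvd c2 + c3"
    using P by (metis prime_dvd_multD)
  moreover have "P dvd c3 + c4" if "P dvd c1 + c2"
    using dvd_diff[OF c[folded P_def] that] by (simp add: algebra_simps)
  moreover have "P dvd c2 + c4" if "P dvd c1 + c3"
    using dvd_diff[OF c[folded P_def] that] by (simp add: algebra_simps)
  moreover have "P dvd c1 + c4" if "P dvd c2 + c3"
    using dvd_diff[OF c[folded P_def] that] by (simp add: algebra_simps)
  ultimately show ?thesis
    unfolding P_def by blast
qed

text \<open>Bounds a single cancellation pattern: the first entry of each pair fixes the second,
  which leaves two free choices.\<close>

lemma card_cancelling_pairs:
  assumes "finite G"
    and inj: "\<And>h1 h2 h3 h4 h2' h4'. ((h1, h2), (h3, h4)) \<in> G \<Longrightarrow>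
      ((h1, h2'), (h3, h4')) \<in> G \<Longrightarrow> h2 = h2' \<and> h4 = h4'"
    and sub: "\<And>h1 h2 h3 h4. ((h1, h2), (h3, h4)) \<in> G \<Longrightarrow> h1 \<in> H \<and> h3 \<in> H" and "finite H"
  shows "card G \<le> card H * card H"
proof -
  have "card G \<le> card (H \<times> H)"
  proof (rule card_inj_on_le)
    show "inj_on (\<lambda>((h1, h2), (h3, h4)). (h1, h3)) G"
    proof (rule inj_onI)
      fix g g' assume *: "g \<in> G" "g' \<in> G"
        "(\<lambda>((h1, h2), (h3, h4)). (h1, h3)) g = (\<lambda>((h1, h2), (h3, h4)). (h1, h3)) g'"
      obtain h1 h2 h3 h4 where g: "g = ((h1, h2), (h3, h4))"
        by (metis surj_pair)
      obtain h1' h2' h3' h4' where g': "g' = ((h1', h2'), (h3', h4'))"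
        by (metis surj_pair)
      show "g = g'"
        using * inj[of h1 h2 h3 h4 h2' h4'] by (simp add: g g')
    qed
    show "(\<lambda>((h1, h2), (h3, h4)). (h1, h3)) ` G \<subseteq> H \<times> H"
      using sub by fastforce
  qed (use assms in auto)
  then show ?thesis
    by (simp add: card_cartesian_product)
qed

text \<open>The four entries cancel in pairs in one of three ways, and each way leaves two units to
  choose.\<close>

lemma card_null_quads_le:
  assumes p: "prime p"
  shows "finite (null_quads p)" "card (null_quads p) \<le> 3 * (p - 1) ^ 2"
proof -
  let ?H = "unit_pairs p"
  show fin: "finite (null_quads p)"
    by (rule finite_subset[of _ "(?H \<times> ?H) \<times> (?H \<times> ?H)"]) (auto simp: null_quads_def)
  define G where "G R = {((h1, h2), (h3, h4)). h1 \<in> ?H \<and> h2 \<in> ?H \<and> h3 \<in> ?H \<and> h4 \<in> ?H \<and>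
      R (fst h1) (fst h2) (fst h3) (fst h4)}" for R :: "int \<Rightarrow> int \<Rightarrow> int \<Rightarrow> int \<Rightarrow> bool"
  define R1 where "R1 = (\<lambda>c1 c2 c3 c4. int p dvd c1 + c2 \<and> int p dvd c3 + c4)"
  \<comment> \<open>The variables are bound in the order \<open>c1 c3 c2 c4\<close>, so this pairs
    the first entry with the third and the second with the fourth.\<close>
  define R2 where "R2 = (\<lambda>c1 c3 c2 c4. int p dvd c1 + c2 \<and> int p dvd c3 + c4)"
  define R3 where "R3 = (\<lambda>c1 c2 c3 c4. int p dvd c2 + c3 \<and> int p dvd c1 + c4)"
  have finG: "finite (G R)" for R
    by (rule finite_subset[of _ "(?H \<times> ?H) \<times> (?H \<times> ?H)"]) (auto simp: G_def)
  have neg: "h = h'" if "h \<in> ?H" "h' \<in> ?H" "e \<in> ?H" "int p dvd fst h + fst e" "int p dvd fst h' + fst e" for h h' e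
    using that unit_pairs_neg_unique[of "fst h" "snd h" p "fst h'" "snd h'" "fst e" "snd e"]
    by (simp add: prod_eq_iff)
  have "card (G R1) \<le> card ?H * card ?H"
  proof (rule card_cancelling_pairs[OF finG])
    fix h1 h2 h3 h4 h2' h4'
    assume "((h1, h2), (h3, h4)) \<in> G R1" "((h1, h2'), (h3, h4')) \<in> G R1"
    then show "h2 = h2' \<and> h4 = h4'"
      using neg[of h2 h2' h1] neg[of h4 h4' h3] by (auto simp: G_def R1_def add.commute)
  qed (auto simp: G_def)
  moreover have "card (G R2) \<le> card ?H * card ?H"
  proof -
    have "card (G R2) \<le> card ((\<lambda>((h1, h2), (h3, h4)). ((h1, h3), (h2, h4))) ` G R1)"
      by (intro card_mono finite_imageI finG)
        (force simp: G_def R1_def R2_def image_iff)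
    also have "\<dots> \<le> card (G R1)"
      by (intro card_image_le finG)
    finally show ?thesis
      using \<open>card (G R1) \<le> _\<close> by simp
  qed
  moreover have "card (G R3) \<le> card ?H * card ?H"
  proof -
    have "card (G R3) \<le> card ((\<lambda>((h1, h2), (h3, h4)). ((h1, h3), (h4, h2))) ` G R1)"
      by (intro card_mono finite_imageI finG)
        (force simp: G_def R1_def R3_def image_iff add.commute)
    also have "\<dots> \<le> card (G R1)"
      by (intro card_image_le finG)
    finally show ?thesis
      using \<open>card (G R1) \<le> _\<close> by simp
  qed
  moreover have "null_quads p \<subseteq> G R1 \<union> G R2 \<union> G R3"
  proof
    fix g assume g: "g \<in> null_quads p"
    obtain c1 d1 c2 d2 c3 d3 c4 d4 where eq: "g = (((c1, d1), (c2, d2)), ((c3, d3), (c4, d4)))"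
      by (metis surj_pair)
    show "g \<in> G R1 \<union> G R2 \<union> G R3"
      using g null_quads_cases[OF p, of c1 d1 c2 d2 c3 d3 c4 d4]
      by (auto simp: eq null_quads_def G_def R1_def R2_def R3_def)
  qed
  then have "card (null_quads p) \<le> card (G R1) + card (G R2) + card (G R3)"
    by (meson card_Un_le card_mono finG finite_UnI le_trans add_le_mono1 order_trans)
  ultimately show "card (null_quads p) \<le> 3 * (p - 1) ^ 2"
    by (simp add: card_unit_pairs_prime[OF p] power2_eq_square)
qed

text \<open>Expand the fourth power over quadruples of unit pairs, then sum over \<open>u\<close>
  and over \<open>v\<close> by orthogonality.\<close>

lemma sum_kloosterman_fourth:
  assumes p: "prime p"
  shows "(\<Sum>u\<in>{0..<int p}. \<Sum>v\<in>{0..<int p}. kloosterman p u v ^ 4) = of_nat (p ^ 2 * card (null_quads p))"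
proof -
  have p0: "p > 0"
    using p by (simp add: prime_gt_0_nat)
  let ?H = "unit_pairs p"
  let ?Q = "(?H \<times> ?H) \<times> (?H \<times> ?H)"
  define C where "C = (\<lambda>((h1::int\<times>int, h2::int\<times>int), (h3::int\<times>int, h4::int\<times>int)). fst h1 + fst h2 + fst h3 + fst h4)"
  define D where "D = (\<lambda>((h1::int\<times>int, h2::int\<times>int), (h3::int\<times>int, h4::int\<times>int)). snd h1 + snd h2 + snd h3 + snd h4)"
  have sq: "sum f A * sum f A = (\<Sum>(x, y)\<in>A \<times> A. f x * f y)" for f :: "'b \<Rightarrow> complex" and A
    by (simp add: sum_product sum.cartesian_product)
  have pow: "kloosterman p u v ^ 4 = (\<Sum>g\<in>?Q. unity_char p (u * C g) * unity_char p (v * D g))" for u v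
  proof -
    have "kloosterman p u v ^ 4 = (kloosterman p u v * kloosterman p u v) * (kloosterman p u v * kloosterman p u v)"
      by (simp add: power4_eq_xxxx)
    also have "\<dots> = (\<Sum>g\<in>?Q. unity_char p (u * C g) * unity_char p (v * D g))"
      unfolding kloosterman_def sq
      by (intro sum.cong) (auto simp: C_def D_def case_prod_unfold algebra_simps simp flip: unity_char_add)
    finally show ?thesis .
  qed
  have "(\<Sum>u\<in>{0..<int p}. \<Sum>v\<in>{0..<int p}. kloosterman p u v ^ 4) =
      (\<Sum>u\<in>{0..<int p}. \<Sum>g\<in>?Q. \<Sum>v\<in>{0..<int p}. unity_char p (u * C g) * unity_char p (v * D g))"
    unfolding pow by (intro sum.cong refl sum.swap)
  also have "\<dots> = (\<Sum>g\<in>?Q. \<Sum>u\<in>{0..<int p}. \<Sum>v\<in>{0..<int p}. unity_char p (u * C g) * unity_char p (v * D g))"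
    by (rule sum.swap)
  also have "\<dots> = (\<Sum>g\<in>?Q. (\<Sum>u\<in>{0..<int p}. unity_char p (u * C g)) * (\<Sum>v\<in>{0..<int p}. unity_char p (v * D g)))"
    by (simp add: sum_product)
  also have "\<dots> = (\<Sum>g\<in>?Q. if int p dvd C g \<and> int p dvd D g then of_nat (p ^ 2) else 0)"
    unfolding sum_unity_char[OF p0] by (intro sum.cong) (auto simp: power2_eq_square)
  also have "\<dots> = (\<Sum>g\<in>{g \<in> ?Q. int p dvd C g \<and> int p dvd D g}. of_nat (p ^ 2))"
    by (rule sum.inter_filter[symmetric]) simp
  also have "{g \<in> ?Q. int p dvd C g \<and> int p dvd D g} = null_quads p"
    by (auto simp: null_quads_def C_def D_def)
  finally show ?thesis
    by (simp add: mult.commute)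
qed

text \<open>By \<open>kloosterman_scale\<close> the value at \<open>(u, v)\<close> is repeated at
  the \<open>p - 1\<close> distinct points \<open>(u * r, v * s)\<close>. Its fourth power is
  therefore at most the whole fourth moment divided by \<open>p - 1\<close>.\<close>

lemma norm_kloosterman_prime:
  assumes p: "prime p" and u: "\<not> int p dvd u" and v: "\<not> int p dvd v"
  shows "norm (kloosterman p u v) ^ 4 \<le> 3 * real p ^ 2 * (real p - 1)"
proof -
  have p0: "p > 0" and p1: "p > 1"
    using prime_gt_0_nat[OF p] prime_gt_1_nat[OF p] by auto
  let ?H = "unit_pairs p" and ?N = "{0..<int p}"
  define K where "K x y = Re (kloosterman p x y) ^ 4" for x y
  have Kre: "kloosterman p x y = of_real (Re (kloosterman p x y))" for x y
    using kloosterman_real[OF p0, of x y] by (simp add: complex_is_Real_iff complex_eq_iff)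
  have K4: "kloosterman p x y ^ 4 = of_real (K x y)" for x y
    unfolding K_def by (subst Kre) simp
  have Kn: "norm (kloosterman p x y) ^ 4 = K x y" for x y
    unfolding K_def by (subst Kre) (simp add: power_even_abs)
  have K0: "K x y \<ge> 0" for x y
    by (simp add: K_def)
  have tot: "(\<Sum>x\<in>?N. \<Sum>y\<in>?N. K x y) = p ^ 2 * card (null_quads p)"
  proof -
    have "complex_of_real (\<Sum>x\<in>?N. \<Sum>y\<in>?N. K x y) = of_real (real (p ^ 2 * card (null_quads p)))"
      using sum_kloosterman_fourth[OF p] unfolding K4 by simp
    then show ?thesis
      by (simp only: of_real_eq_iff)
  qed
  let ?f = "\<lambda>(r, s). (u * r mod int p, v * s mod int p)"
  have Kf: "K (u * r mod int p) (v * s mod int p) = K u v" if "(r, s) \<in> ?H" for r s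
  proof -
    have "kloosterman p (u * r mod int p) (v * s mod int p) = kloosterman p (u * r) (v * s)"
      unfolding kloosterman_def by (intro sum.cong) (auto intro!: unity_char_cong p0 cong_add cong_scalar_right simp: cong_def)
    also have "\<dots> = kloosterman p u v"
      using that by (intro kloosterman_scale p0) (auto simp: unit_pairs_def)
    finally show ?thesis
      by (simp add: K_def)
  qed
  have inj: "inj_on ?f ?H"
  proof (rule inj_onI)
    fix h h' assume *: "h \<in> ?H" "h' \<in> ?H" "?f h = ?f h'"
    obtain r s r' s' where h: "h = (r, s)" "h' = (r', s')"
      by (metis surj_pair)
    have "[u * r = u * r'] (mod int p)"
      using * by (simp add: h cong_def)
    moreover have "coprime u (int p)"
      using u p prime_imp_coprime[of "int p" u] by (simp add: coprime_commute)
    ultimately have "[r = r'] (mod int p)"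
      by (simp add: cong_mult_lcancel)
    then have "r = r'"
      using * by (auto simp: h unit_pairs_def intro: cong_less_imp_eq_int)
    then show "h = h'"
      using *(1,2) unit_pairs_unique by (auto simp: h)
  qed
  have "(real p - 1) * K u v = (\<Sum>h\<in>?H. K u v)"
    using p1 by (simp add: card_unit_pairs_prime[OF p] of_nat_diff)
  also have "\<dots> = (\<Sum>h\<in>?H. (\<lambda>(x, y). K x y) (?f h))"
    using Kf by (intro sum.cong) auto
  also have "\<dots> = (\<Sum>(x, y)\<in>?f ` ?H. K x y)"
    by (simp add: sum.reindex[OF inj])
  also have "\<dots> \<le> (\<Sum>(x, y)\<in>?N \<times> ?N. K x y)"
    using p0 K0 by (intro sum_mono2) auto
  also have "\<dots> = (\<Sum>x\<in>?N. \<Sum>y\<in>?N. K x y)"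
    by (simp add: sum.cartesian_product)
  also have "\<dots> = real p ^ 2 * real (card (null_quads p))"
    unfolding tot by simp
  also have "\<dots> \<le> real p ^ 2 * real (3 * (p - 1) ^ 2)"
    using card_null_quads_le(2)[OF p] by (intro mult_left_mono) (simp_all only: of_nat_le_iff, simp)
  also have "\<dots> = (real p - 1) * (3 * real p ^ 2 * (real p - 1))"
    using p1 by (simp add: of_nat_diff power2_eq_square)
  finally show ?thesis
    using p1 by (simp add: Kn)
qed

section \<open>Local factors\<close>

text \<open>The additive order of \<open>u\<close> modulo \<open>p ^ a\<close> is \<open>p\<close> to this power.\<close>

definition order_exp :: "nat \<Rightarrow> nat \<Rightarrow> int \<Rightarrow> nat"
  where "order_exp p a u = (if u = 0 then 0 else a - multiplicity (int p) u)"

lemma order_exp_le: "order_exp p a u \<le> a"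
  by (simp add: order_exp_def)

lemma not_is_unit_int_prime: "prime p \<Longrightarrow> \<not> is_unit (int p)"
  by (metis not_prime_unit prime_nat_int_transfer)

lemma order_exp_eq_0_iff:
  assumes "prime p"
  shows "order_exp p a u = 0 \<longleftrightarrow> int p ^ a dvd u"
  using power_dvd_iff_le_multiplicity[of u "int p" a] not_is_unit_int_prime[OF assms]
  by (auto simp: order_exp_def)

text \<open>Brings arguments to a common level \<open>m\<close>, the shape in which the lemmas on
  prime power moduli expect them.\<close>

lemma order_exp_decomp:
  assumes "prime p" "order_exp p a u \<le> m" "1 \<le> m" "m \<le> a"
  shows "\<exists>u'. u = int p ^ (a - m) * u' \<and> (int p dvd u' \<longleftrightarrow> order_exp p a u < m)"
proof (cases "u = 0")
  case True
  then show ?thesis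
    using assms by (intro exI[of _ 0]) (auto simp: order_exp_def)
next
  case False
  have p: "int p \<noteq> 0"
    using assms by auto
  have iff: "int p ^ k dvd u \<longleftrightarrow> k \<le> multiplicity (int p) u" for k
    using False not_is_unit_int_prime[OF assms(1)] by (intro power_dvd_iff_le_multiplicity) auto
  have "int p ^ (a - m) dvd u"
    using assms False unfolding iff by (simp add: order_exp_def)
  then obtain u' where u': "u = int p ^ (a - m) * u'"
    by blast
  have "int p dvd u' \<longleftrightarrow> int p ^ Suc (a - m) dvd u"
    using p unfolding u' by (simp add: mult.commute)
  also have "\<dots> \<longleftrightarrow> order_exp p a u < m"
    using False assms unfolding iff by (auto simp: order_exp_def)
  finally show ?thesis
    using u' by blast
qed

text \<open>Factors prime to \<open>p\<close> preserve the order and each factor \<open>p\<close>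
  lowers the exponent by one, until the truncated difference stops at 0.\<close>

lemma order_exp_mult:
  assumes "prime p" "\<not> int p dvd w"
  shows "order_exp p a (w * u * int p ^ i) = order_exp p a u - i"
proof -
  have p: "prime (int p)" and p0: "int p \<noteq> 0"
    using assms by auto
  have w: "w \<noteq> 0" "multiplicity (int p) w = 0"
    using assms by (auto intro: not_dvd_imp_multiplicity_0)
  show ?thesis
  proof (cases "u = 0")
    case False
    have "multiplicity (int p) (w * u * int p ^ i) = multiplicity (int p) u + i"
      using False w p0 p by (simp add: prime_elem_multiplicity_mult_distrib multiplicity_same_power
          not_prime_unit)
    then show ?thesis
      using False w p0 by (simp add: order_exp_def)
  qed (simp add: order_exp_def)
qed

section \<open>Normalised Kloosterman sums and their decay\<close>

text \<open>Taking the real part loses nothing, as Kloosterman sums to a positive modulus are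
  real.\<close>

definition nkloosterman :: "nat \<Rightarrow> nat \<Rightarrow> int \<Rightarrow> int \<Rightarrow> real"
  where "nkloosterman p a u v = Re (kloosterman (p ^ a) u v) / card (unit_pairs (p ^ a))"

text \<open>This is \<open>2 * p powr (- 1/4)\<close>, the bound that the fourth moment yields at a
  prime \<open>p \<ge> 3\<close> where both frequencies are nontrivial.\<close>

definition decay :: "nat \<Rightarrow> real"
  where "decay p = 2 / sqrt (sqrt (real p))"

lemma card_unit_pairs_pos:
  assumes "prime p" "a \<ge> 1"
  shows "real (card (unit_pairs (p ^ a))) = real p ^ (a - 1) * (real p - 1)"
    "real p ^ (a - 1) * (real p - 1) > 0"
  using prime_gt_1_nat[OF assms(1)] assms by (auto simp: card_unit_pairs of_nat_diff)

lemma nkloosterman_swap: "nkloosterman p a u v = nkloosterman p a v u"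
  by (simp add: nkloosterman_def kloosterman_swap[of _ u v])

lemma abs_nkloosterman_le:
  assumes "prime p" "a \<ge> 1" "norm (kloosterman (p ^ a) u v) \<le> real p ^ (a - 1) * x"
  shows "\<bar>nkloosterman p a u v\<bar> \<le> x / (real p - 1)"
proof -
  have "\<bar>Re (kloosterman (p ^ a) u v)\<bar> \<le> real p ^ (a - 1) * x"
    using abs_Re_le_cmod[of "kloosterman (p ^ a) u v"] assms(3) by linarith
  then have "\<bar>nkloosterman p a u v\<bar> \<le> (real p ^ (a - 1) * x) / (real p ^ (a - 1) * (real p - 1))"
    unfolding nkloosterman_def card_unit_pairs_pos(1)[OF assms(1,2)] abs_divide
    using card_unit_pairs_pos(2)[OF assms(1,2)] by (intro frac_le) auto
  also have "\<dots> = x / (real p - 1)"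
    using prime_gt_0_nat[OF assms(1)] by simp
  finally show ?thesis .
qed

lemma abs_nkloosterman_le_1:
  assumes "prime p" "a \<ge> 1"
  shows "\<bar>nkloosterman p a u v\<bar> \<le> 1"
proof -
  have "\<bar>nkloosterman p a u v\<bar> \<le> (real p - 1) / (real p - 1)"
    using norm_kloosterman_le[of "p ^ a" u v] card_unit_pairs_pos[OF assms] assms
    by (intro abs_nkloosterman_le) auto
  also have "\<dots> = 1"
    using prime_gt_1_nat[OF assms(1)] by simp
  finally show ?thesis .
qed

lemma nkloosterman_eq_1:
  assumes "prime p" "a \<ge> 1" "order_exp p a u = 0" "order_exp p a v = 0"
  shows "nkloosterman p a u v = 1"
proof -
  have "kloosterman (p ^ a) u v = card (unit_pairs (p ^ a))"
    using assms prime_gt_0_nat[OF assms(1)] by (intro kloosterman_trivial) (auto simp: order_exp_eq_0_iff)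
  then show ?thesis
    using card_unit_pairs_pos[OF assms(1,2)] unfolding nkloosterman_def by auto
qed

text \<open>Written at the level of \<open>u\<close>, the cofactor of \<open>u\<close> is prime to
  \<open>p\<close> and that of \<open>v\<close> is not, so the restricted sum is empty.\<close>

lemma nkloosterman_eq_0:
  assumes p: "prime p" and "order_exp p a v < order_exp p a u" "2 \<le> order_exp p a u"
  shows "nkloosterman p a u v = 0"
proof -
  let ?s = "order_exp p a u"
  have s: "2 \<le> ?s" "?s \<le> a" and s1: "1 \<le> ?s"
    using assms order_exp_le by auto
  obtain u' where u: "u = int p ^ (a - ?s) * u'" and ud: "int p dvd u' \<longleftrightarrow> order_exp p a u < ?s"
    using order_exp_decomp[OF p order_refl s1 s(2)] by blast
  obtain v' where v: "v = int p ^ (a - ?s) * v'" and vd: "int p dvd v' \<longleftrightarrow> order_exp p a v < ?s"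
    using order_exp_decomp[OF p less_imp_le[OF assms(2)] s1 s(2)] by blast
  have "kloosterman (p ^ a) (int p ^ (a - ?s) * u') (int p ^ (a - ?s) * v') = 0"
    using ud vd assms(2) by (intro kloosterman_eq_0[OF p s]) auto
  then show ?thesis
    by (simp add: nkloosterman_def flip: u v)
qed

text \<open>The sum vanishes if \<open>u\<close> has order exponent at least 2. At exponent 1 it
  reduces to the Ramanujan sum -1 against \<open>p - 1\<close> terms.\<close>

lemma nkloosterman_ramanujan:
  assumes p: "prime p" and u: "order_exp p a u \<ge> 1" and v: "order_exp p a v = 0"
  shows "\<bar>nkloosterman p a u v\<bar> \<le> 1 / (real p - 1)"
proof (cases "order_exp p a u \<ge> 2")
  case True
  then show ?thesis
    using nkloosterman_eq_0[OF p, of a v u] v prime_gt_1_nat[OF p] by simp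
next
  case False
  then have s: "order_exp p a u = 1" "1 \<le> a" and v1: "order_exp p a v \<le> 1"
    using u v order_exp_le[of p a u] by auto
  obtain u' where u': "u = int p ^ (a - 1) * u'" and u'd: "int p dvd u' \<longleftrightarrow> order_exp p a u < 1"
    using order_exp_decomp[OF p eq_refl[OF s(1)] order_refl s(2)] by blast
  obtain v' where v': "v = int p ^ (a - 1) * v'" and v'd: "int p dvd v' \<longleftrightarrow> order_exp p a v < 1"
    using order_exp_decomp[OF p v1 order_refl s(2)] by blast
  have "kloosterman (p ^ a) u v = - of_nat (p ^ (a - 1))"
    using kloosterman_prime_right_0[OF p, of u' v'] u'd v'd s v
    unfolding u' v' kloosterman_reduce[OF p s(2), of u' v'] by simp
  then have "norm (kloosterman (p ^ a) u v) \<le> real p ^ (a - 1) * 1"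
    by (simp add: norm_power)
  from abs_nkloosterman_le[OF p s(2) this] show ?thesis .
qed

lemma decay_pos: "p > 0 \<Longrightarrow> decay p > 0"
  by (simp add: decay_def)

lemma decay_power4: "decay p ^ 4 = 16 / real p"
proof -
  have "sqrt (sqrt (real p)) ^ 4 = (sqrt (sqrt (real p)) ^ 2) ^ 2"
    by (subst power_mult[symmetric]) simp
  also have "\<dots> = real p"
    by simp
  finally show ?thesis
    by (simp add: decay_def power_divide)
qed

text \<open>Different orders give 0, and a common exponent of at least 2 gives the stronger bound
  \<open>2 / (p - 1)\<close>. Only when both exponents are 1 is the fourth moment needed.\<close>

lemma nkloosterman_le_decay:
  assumes p: "prime p" "p \<ge> 3" and u: "order_exp p a u \<ge> 1" and v: "order_exp p a v \<ge> 1"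
  shows "\<bar>nkloosterman p a u v\<bar> \<le> decay p"
proof -
  have a: "a \<ge> 1"
    using u order_exp_le[of p a u] by simp
  have k0: "decay p > 0"
    using p by (intro decay_pos) simp
  consider "order_exp p a u \<noteq> order_exp p a v" | "order_exp p a u = order_exp p a v" "order_exp p a u \<ge> 2"
    | "order_exp p a u = 1" "order_exp p a v = 1"
    using u by linarith
  then show ?thesis
  proof cases
    case 1
    then have "nkloosterman p a u v = 0"
      using nkloosterman_eq_0[OF p(1), of a v u] nkloosterman_eq_0[OF p(1), of a u v] u v nkloosterman_swap[of p a u v]
      by (metis Suc_1 Suc_leI le_neq_implies_less less_le_trans nat_neq_iff not_less One_nat_def)
    then show ?thesis
      using k0 by simp
  next
    case 2
    let ?s = "order_exp p a u"
    have s: "2 \<le> ?s" "?s \<le> a" and s1: "1 \<le> ?s"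
      using 2 order_exp_le by auto
    obtain u' where u': "u = int p ^ (a - ?s) * u'" and u'd: "int p dvd u' \<longleftrightarrow> order_exp p a u < ?s"
      using order_exp_decomp[OF p(1) order_refl s1 s(2)] by blast
    obtain v' where v': "v = int p ^ (a - ?s) * v'" and v'd: "int p dvd v' \<longleftrightarrow> order_exp p a v < ?s"
      using order_exp_decomp[OF p(1) eq_refl[OF 2(1)[symmetric]] s1 s(2)] by blast
    have "norm (kloosterman (p ^ a) u v) \<le> real p ^ (a - 1) * 2"
      using norm_kloosterman_higher[OF p(1) s, of u' v'] u'd by (simp flip: u' v')
    from abs_nkloosterman_le[OF p(1) a this] have "\<bar>nkloosterman p a u v\<bar> \<le> 2 / (real p - 1)" .
    also have "\<dots> \<le> decay p"
    proof -
      have "sqrt (sqrt (real p)) \<le> sqrt (real p)"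
        using p by (intro real_sqrt_le_mono real_le_lsqrt) (auto simp: power2_eq_square)
      also have "\<dots> \<le> real p - 1"
      proof (rule real_le_lsqrt)
        have "real p * 3 \<le> real p * real p"
          using p by (intro mult_left_mono) auto
        moreover have "(real p - 1)\<^sup>2 = real p * real p - 2 * real p + 1"
          by (simp add: power2_eq_square algebra_simps)
        ultimately show "real p \<le> (real p - 1)\<^sup>2"
          by linarith
      qed (use p in auto)
      finally show ?thesis
        using p unfolding decay_def by (intro divide_left_mono) auto
    qed
    finally show ?thesis .
  next
    case 3
    obtain u' where u': "u = int p ^ (a - 1) * u'" and u'd: "int p dvd u' \<longleftrightarrow> order_exp p a u < 1"
      using order_exp_decomp[OF p(1) eq_refl[OF 3(1)] order_refl a] by blast
    obtain v' where v': "v = int p ^ (a - 1) * v'" and v'd: "int p dvd v' \<longleftrightarrow> order_exp p a v < 1"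
      using order_exp_decomp[OF p(1) eq_refl[OF 3(2)] order_refl a] by blast
    define N where "N = norm (kloosterman p u' v')"
    have "norm (kloosterman (p ^ a) u v) = real p ^ (a - 1) * N"
      unfolding u' v' kloosterman_reduce[OF p(1) a, of u' v'] by (simp add: norm_mult norm_power N_def)
    then have k: "\<bar>nkloosterman p a u v\<bar> \<le> N / (real p - 1)"
      by (intro abs_nkloosterman_le p a) simp
    have "(N / (real p - 1)) ^ 4 \<le> decay p ^ 4"
    proof -
      have p3: "real p \<ge> 3"
        using p by simp
      have "N ^ 4 \<le> 3 * real p ^ 2 * (real p - 1)"
        unfolding N_def by (rule norm_kloosterman_prime[OF p(1)]) (use u'd v'd 3 in auto)
      then have "N ^ 4 * real p \<le> 3 * real p ^ 2 * (real p - 1) * real p"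
        by (intro mult_right_mono) auto
      also have "\<dots> = 3 * real p ^ 3 * (real p - 1)"
        by (simp add: power2_eq_square power3_eq_cube)
      also have "\<dots> \<le> 16 * (real p - 1) ^ 3 * (real p - 1)"
      proof (rule mult_right_mono)
        \<comment> \<open>This holds for \<open>p \<ge> 3\<close> and leads to
          \<open>3 * (3 / 2) ^ 3 = 81 / 8\<close>, which is below the 16 produced by the constant 2
          in \<open>decay\<close>.\<close>
        have "real p \<le> 3 / 2 * (real p - 1)"
          using p3 by simp
        then have "real p ^ 3 \<le> (3 / 2 * (real p - 1)) ^ 3"
          by (intro power_mono) auto
        also have "\<dots> = 27 / 8 * (real p - 1) ^ 3"
          unfolding power_mult_distrib power_divide by simp
        finally have "3 * real p ^ 3 \<le> 81 / 8 * (real p - 1) ^ 3"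
          by simp
        also have "\<dots> \<le> 16 * (real p - 1) ^ 3"
          using p3 by (intro mult_right_mono) auto
        finally show "3 * real p ^ 3 \<le> 16 * (real p - 1) ^ 3" .
      qed (use p3 in auto)
      also have "\<dots> = 16 * (real p - 1) ^ 4"
        by (simp add: power4_eq_xxxx power3_eq_cube)
      finally have "N ^ 4 / (real p - 1) ^ 4 \<le> 16 / real p"
        using p3 by (simp add: field_simps)
      then show ?thesis
        by (simp add: decay_power4 power_divide)
    qed
    then have "(N / (real p - 1)) ^ Suc 3 \<le> decay p ^ Suc 3"
      by (simp only: Suc_numeral semiring_norm)
    then have "N / (real p - 1) \<le> decay p"
      by (rule power_le_imp_le_base) (use k0 in simp)
    then show ?thesis
      by (rule order_trans[OF k])
  qed
qed

text \<open>Outside the excluded cases either both arguments are trivial, with value 1, or the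
  orders differ and the larger exponent is at least 2, with value 0.\<close>

lemma nkloosterman_nonneg:
  assumes p: "prime p" "a \<ge> 1"
    and ne: "order_exp p a u = order_exp p a v \<Longrightarrow> order_exp p a u = 0"
      "\<not> (order_exp p a u = 0 \<and> order_exp p a v = 1)" "\<not> (order_exp p a u = 1 \<and> order_exp p a v = 0)"
  shows "nkloosterman p a u v \<ge> 0"
proof -
  consider "order_exp p a u = 0" "order_exp p a v = 0" | "order_exp p a v < order_exp p a u" "2 \<le> order_exp p a u"
    | "order_exp p a u < order_exp p a v" "2 \<le> order_exp p a v"
    using ne by linarith
  then show ?thesis
    by cases (use p nkloosterman_eq_1[of p a u v] nkloosterman_eq_0[of p a v u] nkloosterman_eq_0[of p a u v] nkloosterman_swap[of p a u v] in auto)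
qed

section \<open>The transform of the measure at one prime\<close>

text \<open>The Fourier transform at \<open>(x, y)\<close> of the random point
  \<open>(p ^ i * c, p ^ (b - i) * w * d)\<close>, with \<open>i\<close> uniform in
  \<open>{..b}\<close> and \<open>(c, d)\<close> a random unit pair. The factor \<open>m\<close> is
  the twist of the character that the Chinese remainder theorem produces. The choice
  \<open>b = 0\<close> serves the large primes.\<close>

definition local_factor :: "nat \<Rightarrow> nat \<Rightarrow> nat \<Rightarrow> int \<Rightarrow> int \<Rightarrow> int \<Rightarrow> int \<Rightarrow> real"
  where "local_factor p a b m w x y =
    (\<Sum>i\<le>b. nkloosterman p a (m * x * int p ^ i) (m * w * y * int p ^ (b - i))) / (real b + 1)"

lemma local_factor_bounds:
  assumes p: "prime p" "a \<ge> 1" and m: "\<not> int p dvd m" and w: "\<not> int p dvd w"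
  shows "\<bar>local_factor p a b m w x y\<bar> \<le> 1" "local_factor p a b m w x y \<ge> - 3 / (real b + 1)"
proof -
  let ?k = "\<lambda>i. nkloosterman p a (m * x * int p ^ i) (m * w * y * int p ^ (b - i))"
  have le1: "\<bar>?k i\<bar> \<le> 1" for i
    using p by (rule abs_nkloosterman_le_1)
  have "\<bar>\<Sum>i\<le>b. ?k i\<bar> \<le> (\<Sum>i\<le>b. \<bar>?k i\<bar>)"
    by (rule sum_abs)
  also have "\<dots> \<le> (\<Sum>i\<le>b. 1)"
    using le1 by (intro sum_mono)
  finally show "\<bar>local_factor p a b m w x y\<bar> \<le> 1"
    by (simp add: local_factor_def abs_divide)
  have mw: "\<not> int p dvd m * w"
    using m w p by (simp add: prime_dvd_mult_iff)
  define s where "s = order_exp p a x"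
  define t where "t = order_exp p a y"
  have ou: "order_exp p a (m * x * int p ^ i) = s - i" for i
    unfolding s_def by (rule order_exp_mult[OF p(1) m])
  have ov: "order_exp p a (m * w * y * int p ^ (b - i)) = t - (b - i)" for i
    unfolding t_def by (rule order_exp_mult[OF p(1) mw])
  \<comment> \<open>The order exponents at \<open>i\<close> are \<open>s - i\<close> and
    \<open>t - (b - i)\<close>. They are 1 and 0 only for \<open>i = s - 1\<close>, 0 and 1 only for
    \<open>i = b + 1 - t\<close>, and equal and positive only for \<open>2 * i = s + b - t\<close>.
    By \<open>nkloosterman_nonneg\<close> no other \<open>i\<close> gives a negative term.\<close>
  define N where "N = {s - 1, b + 1 - t, (s + b - t) div 2}"
  have nonneg: "?k i \<ge> 0" if "i \<in> {..b} - N" for i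
    by (rule nkloosterman_nonneg[OF p]) (use that in \<open>auto simp: ou ov N_def\<close>)
  have rest: "0 \<le> (\<Sum>i\<in>{..b} - N. ?k i)"
    using nonneg by (intro sum_nonneg)
  have "card N \<le> 3"
    unfolding N_def by (simp add: card_insert_if)
  then have "card ({..b} \<inter> N) \<le> 3"
    by (rule order_trans[rotated]) (auto intro: card_mono simp: N_def)
  then have "- 3 \<le> - real (card ({..b} \<inter> N))"
    by simp
  also have "\<dots> = (\<Sum>i\<in>{..b} \<inter> N. - 1)"
    by simp
  also have "\<dots> \<le> (\<Sum>i\<in>{..b} \<inter> N. ?k i)"
    using le1 by (intro sum_mono) (simp add: abs_le_iff)
  also have "\<dots> \<le> (\<Sum>i\<in>{..b} \<inter> N. ?k i) + (\<Sum>i\<in>{..b} - N. ?k i)"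
    using rest by simp
  also have "\<dots> = (\<Sum>i\<le>b. ?k i)"
    by (rule sum.Int_Diff[symmetric]) simp
  finally show "local_factor p a b m w x y \<ge> - 3 / (real b + 1)"
    unfolding local_factor_def by (intro divide_right_mono) auto
qed

text \<open>For \<open>b = 0\<close> the average is a single normalised Kloosterman sum: complete,
  of Ramanujan type or with both frequencies nontrivial, in this order.\<close>

lemma local_factor_0_bounds:
  assumes p: "prime p" "a \<ge> 1" "p \<ge> 3" and m: "\<not> int p dvd m" and w: "\<not> int p dvd w"
  shows "int p ^ a dvd x \<Longrightarrow> int p ^ a dvd y \<Longrightarrow> local_factor p a 0 m w x y = 1"
    and "\<not> (int p ^ a dvd x \<longleftrightarrow> int p ^ a dvd y) \<Longrightarrow> \<bar>local_factor p a 0 m w x y\<bar> \<le> 1 / (real p - 1)"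
    and "\<not> int p ^ a dvd x \<Longrightarrow> \<not> int p ^ a dvd y \<Longrightarrow> \<bar>local_factor p a 0 m w x y\<bar> \<le> decay p"
proof -
  have mw: "\<not> int p dvd m * w"
    using m w p by (simp add: prime_dvd_mult_iff)
  have l: "local_factor p a 0 m w x y = nkloosterman p a (m * x) (m * w * y)"
    by (simp add: local_factor_def)
  have o: "order_exp p a (m * x) = order_exp p a x" "order_exp p a (m * w * y) = order_exp p a y"
    using order_exp_mult[OF p(1) m, of a x 0] order_exp_mult[OF p(1) mw, of a y 0] by simp_all
  note o' = order_exp_eq_0_iff[OF p(1), of a x, symmetric] order_exp_eq_0_iff[OF p(1), of a y, symmetric]
  show "int p ^ a dvd x \<Longrightarrow> int p ^ a dvd y \<Longrightarrow> local_factor p a 0 m w x y = 1"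
    using p by (simp add: l nkloosterman_eq_1 o o')
  show "\<not> (int p ^ a dvd x \<longleftrightarrow> int p ^ a dvd y) \<Longrightarrow> \<bar>local_factor p a 0 m w x y\<bar> \<le> 1 / (real p - 1)"
    using nkloosterman_ramanujan[OF p(1), of a "m * x" "m * w * y"] nkloosterman_ramanujan[OF p(1), of a "m * w * y" "m * x"]
      nkloosterman_swap[of p a "m * x" "m * w * y"]
    unfolding l o' o by (cases "order_exp p a x = 0") auto
  show "\<not> int p ^ a dvd x \<Longrightarrow> \<not> int p ^ a dvd y \<Longrightarrow> \<bar>local_factor p a 0 m w x y\<bar> \<le> decay p"
    using p by (auto simp: l o o' intro!: nkloosterman_le_decay)
qed

section \<open>Gluing by the Chinese remainder theorem\<close>

definition cofactor_inv :: "nat \<Rightarrow> nat \<Rightarrow> int"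
  where "cofactor_inv q p = (SOME m. [m * int (q div p ^ multiplicity p q) = 1] (mod int (p ^ multiplicity p q)))"

lemma cofactor_inv:
  assumes "q > 0" "prime p"
  shows "[cofactor_inv q p * int (q div p ^ multiplicity p q) = 1] (mod int (p ^ multiplicity p q))"
proof -
  have "coprime p (q div p ^ multiplicity p q)"
    using assms by (intro prime_imp_coprime multiplicity_decompose) (auto dest: not_prime_unit)
  then have "coprime (int (q div p ^ multiplicity p q)) (int (p ^ multiplicity p q))"
    by (simp add: coprime_commute)
  then obtain m where "[int (q div p ^ multiplicity p q) * m = 1] (mod int (p ^ multiplicity p q))"
    using cong_solve_coprime_int by blast
  then have "[m * int (q div p ^ multiplicity p q) = 1] (mod int (p ^ multiplicity p q))"
    by (subst mult.commute)
  then show ?thesis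
    unfolding cofactor_inv_def by (rule someI)
qed

lemma not_dvd_cofactor_inv:
  assumes "q > 0" "prime p" "p dvd q"
  shows "\<not> int p dvd cofactor_inv q p"
proof
  assume "int p dvd cofactor_inv q p"
  moreover have "int p dvd int (p ^ multiplicity p q)"
    using assms by (simp add: prime_multiplicity_gt_zero_iff[of p q] dvd_power)
  ultimately have "int p dvd 1"
    using cofactor_inv[OF assms(1,2)]
    by (meson cong_dvd_iff cong_dvd_modulus dvd_mult2)
  then show False
    using not_is_unit_int_prime[OF assms(2)] by simp
qed

lemma cong_prime_powers:
  assumes "q > 0" "\<And>p. p \<in> prime_factors q \<Longrightarrow> [x = y] (mod int (p ^ multiplicity p q))"
  shows "[x = y] (mod int q)"
proof -
  have "[x = y] (mod (\<Prod>p\<in>prime_factors q. int (p ^ multiplicity p q)))"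
  proof (rule cong_cong_prod_coprime; intro ballI impI)
    fix p p' assume "p \<in> prime_factors q" "p' \<in> prime_factors q" "p \<noteq> p'"
    then have "coprime p p'"
      by (intro primes_coprime) auto
    then show "coprime (int (p ^ multiplicity p q)) (int (p' ^ multiplicity p' q))"
      by simp
  qed (rule assms(2))
  also have "(\<Prod>p\<in>prime_factors q. int (p ^ multiplicity p q)) = int q"
    unfolding of_nat_prod[symmetric] by (rule arg_cong[OF prime_factorization_nat[OF assms(1), symmetric]])
  finally show ?thesis .
qed

text \<open>For each exponent \<open>i\<close> the sum over unit pairs is a Kloosterman sum, and all
  \<open>i\<close> carry equal weight.\<close>

lemma sum_unity_char_local:
  assumes p: "prime p" "a \<ge> 1"
  shows "(\<Sum>j\<in>{..b} \<times> unit_pairs (p ^ a). unity_char (p ^ a) (m * (x * (int p ^ fst j * fst (snd j)) +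
      y * (int p ^ (b - fst j) * w * snd (snd j))))) =
    of_real (real (card ({..b} \<times> unit_pairs (p ^ a))) * local_factor p a b m w x y)"
proof -
  let ?H = "unit_pairs (p ^ a)"
  have p0: "p ^ a > 0"
    using prime_gt_0_nat[OF p(1)] by simp
  have H0: "real (card ?H) \<noteq> 0"
    using card_unit_pairs_pos[OF p] by (metis less_irrefl)
  have K: "kloosterman (p ^ a) u v = of_real (real (card ?H) * nkloosterman p a u v)" for u v
    using kloosterman_real[OF p0, of u v] H0 by (simp add: nkloosterman_def complex_is_Real_iff complex_eq_iff)
  have "(\<Sum>j\<in>{..b} \<times> ?H. unity_char (p ^ a) (m * (x * (int p ^ fst j * fst (snd j)) +
      y * (int p ^ (b - fst j) * w * snd (snd j))))) =
    (\<Sum>i\<le>b. \<Sum>h\<in>?H. unity_char (p ^ a) (m * (x * (int p ^ i * fst h) + y * (int p ^ (b - i) * w * snd h))))"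
    by (subst sum.cartesian_product) (simp add: case_prod_unfold)
  also have "\<dots> = (\<Sum>i\<le>b. kloosterman (p ^ a) (m * x * int p ^ i) (m * w * y * int p ^ (b - i)))"
    unfolding kloosterman_def by (intro sum.cong) (auto simp: case_prod_unfold algebra_simps)
  also have "\<dots> = of_real (real (card ?H) * (\<Sum>i\<le>b. nkloosterman p a (m * x * int p ^ i) (m * w * y * int p ^ (b - i))))"
    unfolding K by (simp add: sum_distrib_left)
  also have "(\<Sum>i\<le>b. nkloosterman p a (m * x * int p ^ i) (m * w * y * int p ^ (b - i))) =
      (real b + 1) * local_factor p a b m w x y"
    by (simp add: local_factor_def)
  finally show ?thesis
    by (simp add: card_cartesian_product algebra_simps)
qed

text \<open>A point \<open>z\<close> chooses a local point at each prime independently, and the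
  Chinese remainder theorem glues the choices. Characters modulo \<open>q\<close> split accordingly,
  so the sum over all choice functions is a product of local sums.\<close>

lemma product_family:
  fixes b :: "nat \<Rightarrow> nat"
  assumes q: "q > 0"
  obtains Z :: "(nat \<Rightarrow> nat \<times> int \<times> int) set" and X Y :: "(nat \<Rightarrow> nat \<times> int \<times> int) \<Rightarrow> int"
    and m w :: "nat \<Rightarrow> int"
  where "finite Z" "Z \<noteq> {}"
    and "\<And>z. z \<in> Z \<Longrightarrow> [X z * Y z = (\<Prod>p\<in>prime_factors q. int p ^ b p)] (mod int q)"
    and "\<And>p. p \<in> prime_factors q \<Longrightarrow> \<not> int p dvd m p \<and> \<not> int p dvd w p"
    and "\<And>x y. (\<Sum>z\<in>Z. unity_char q (x * X z + y * Y z)) =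
      of_real (card Z * (\<Prod>p\<in>prime_factors q. local_factor p (multiplicity p q) (b p) (m p) (w p) x y))"
proof -
  define Pr where "Pr = prime_factors q"
  define a where "a p = multiplicity p q" for p
  define n where "n p = p ^ a p" for p
  define Q where "Q p = q div n p" for p
  define m where "m = cofactor_inv q"
  \<comment> \<open>The local product at \<open>p\<close> is \<open>p ^ b p * w p\<close>. Taking
    for \<open>w p\<close> the prime powers of the other primes makes all local targets residues of
    one integer.\<close>
  define w where "w p = (\<Prod>p'\<in>Pr - {p}. int p' ^ b p')" for p
  define J where "J p = {..b p} \<times> unit_pairs (n p)" for p
  define x where "x p j = int p ^ fst j * fst (snd j)" for p and j :: "nat \<times> int \<times> int"
  define y where "y p j = int p ^ (b p - fst j) * w p * snd (snd j)" for p and j :: "nat \<times> int \<times> int"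
  define X where "X z = (\<Sum>p\<in>Pr. x p (z p) * m p * int (Q p))" for z
  define Y where "Y z = (\<Sum>p\<in>Pr. y p (z p) * m p * int (Q p))" for z
  have fin: "finite Pr"
    by (simp add: Pr_def)
  have p: "prime p" "a p \<ge> 1" "n p > 0" "p dvd q" if "p \<in> Pr" for p
    using that q by (auto simp: Pr_def n_def a_def in_prime_factors_iff prime_gt_0_nat
        intro!: Suc_leI prime_multiplicity_gt_zero_iff[THEN iffD2])
  have nQ: "q = n p * Q p" for p
    unfolding Q_def n_def a_def using multiplicity_dvd[of p q] by simp
  have Q0: "Q p > 0" for p
    using nQ[of p] q by (metis gr0I mult_0_right)
  have mQ: "[m p * int (Q p) = 1] (mod int (n p))" if "p \<in> Pr" for p
    using cofactor_inv[OF q p(1)[OF that]] by (simp add: m_def Q_def n_def a_def)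
  have nQ': "int (n p) dvd int (Q p')" if "p \<in> Pr" "p' \<in> Pr" "p \<noteq> p'" for p p'
  proof -
    have "coprime (n p) (n p')"
      using that p by (simp add: n_def primes_coprime)
    moreover have "n p dvd n p' * Q p'"
      using nQ[of p] nQ[of p'] by (metis dvd_triv_left)
    ultimately show ?thesis
      by (simp add: coprime_dvd_mult_right_iff)
  qed
  \<comment> \<open>Modulo \<open>n p\<close> every other summand vanishes because
    \<open>n p\<close> divides its cofactor, and \<open>m p * Q p\<close> is 1.\<close>
  have crt: "[(\<Sum>p'\<in>Pr. f p' * m p' * int (Q p')) = f p] (mod int (n p))" if "p \<in> Pr" for f p
  proof -
    have "(\<Sum>p'\<in>Pr. f p' * m p' * int (Q p')) =
        f p * (m p * int (Q p)) + (\<Sum>p'\<in>Pr - {p}. f p' * m p' * int (Q p'))"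
      using fin that by (simp add: sum.remove[of Pr p] mult.assoc)
    moreover have "int (n p) dvd (\<Sum>p'\<in>Pr - {p}. f p' * m p' * int (Q p'))"
      by (intro dvd_sum dvd_mult) (use nQ' that in blast)
    then have "[f p * (m p * int (Q p)) + (\<Sum>p'\<in>Pr - {p}. f p' * m p' * int (Q p')) = f p * 1 + 0] (mod int (n p))"
      by (intro cong_add cong_scalar_left mQ that) (simp add: cong_0_iff)
    ultimately show ?thesis
      by simp
  qed
  have w: "\<not> int p dvd w p" if pP: "p \<in> Pr" for p
  proof
    assume "int p dvd w p"
    then obtain p' where p': "p' \<in> Pr - {p}" "int p dvd int p' ^ b p'"
      unfolding w_def using fin p[OF pP] by (metis (no_types, lifting) finite_Diff prime_dvd_prod_iff prime_nat_int_transfer)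
    then have "p dvd p'"
      using p(1)[OF pP] by (metis of_nat_dvd_iff of_nat_power prime_dvd_power)
    then show False
      using p(1)[OF pP] p(1)[of p'] p' by (auto dest: primes_dvd_imp_eq)
  qed
  define Z where "Z = PiE Pr J"
  show ?thesis
  proof (rule that[of Z X Y m w])
    show "finite Z"
      unfolding Z_def J_def by (intro finite_PiE fin) auto
    have "J p \<noteq> {}" if "p \<in> Pr" for p
    proof -
      have "unit_pairs (n p) \<noteq> {}"
        using card_unit_pairs_pos[OF p(1,2)[OF that]] by (auto simp: n_def)
      then show ?thesis
        by (auto simp: J_def)
    qed
    then show "Z \<noteq> {}"
      by (simp add: Z_def PiE_eq_empty_iff)
    show "\<not> int p dvd m p \<and> \<not> int p dvd w p" if "p \<in> prime_factors q" for p
      using w not_dvd_cofactor_inv[OF q] that p by (simp add: Pr_def m_def)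
    show "[X z * Y z = (\<Prod>p\<in>prime_factors q. int p ^ b p)] (mod int q)" if z: "z \<in> Z" for z
    proof (rule cong_prime_powers[OF q])
      fix p assume "p \<in> prime_factors q"
      then have pPr: "p \<in> Pr"
        by (simp add: Pr_def)
      then obtain i c d where j: "z p = (i, c, d)" "i \<le> b p" "(c, d) \<in> unit_pairs (n p)"
        using z by (auto simp: Z_def J_def PiE_iff)
      have "[X z * Y z = x p (z p) * y p (z p)] (mod int (n p))"
        unfolding X_def Y_def by (intro cong_mult crt pPr)
      also have "x p (z p) * y p (z p) = (int p ^ i * int p ^ (b p - i) * w p) * (c * d)"
        by (simp add: x_def y_def j)
      also have "int p ^ i * int p ^ (b p - i) = int p ^ b p"
        using j by (simp flip: power_add)
      also have "[int p ^ b p * w p * (c * d) = int p ^ b p * w p * 1] (mod int (n p))"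
        using j by (intro cong_scalar_left) (auto simp: unit_pairs_def)
      also have "int p ^ b p * w p * 1 = (\<Prod>p\<in>prime_factors q. int p ^ b p)"
        using prod.remove[OF fin pPr, of "\<lambda>p. int p ^ b p"] by (simp add: w_def flip: Pr_def)
      finally show "[X z * Y z = (\<Prod>p\<in>prime_factors q. int p ^ b p)] (mod int (p ^ multiplicity p q))"
        by (simp add: n_def a_def)
    qed
    fix u v
    have "(\<Sum>z\<in>Z. unity_char q (u * X z + v * Y z)) =
        (\<Sum>z\<in>Z. \<Prod>p\<in>Pr. unity_char (n p) (m p * (u * x p (z p) + v * y p (z p))))"
    proof (rule sum.cong[OF refl])
      fix z
      have "u * X z + v * Y z = (\<Sum>p\<in>Pr. int (Q p) * (m p * (u * x p (z p) + v * y p (z p))))"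
        by (simp add: X_def Y_def sum_distrib_left algebra_simps flip: sum.distrib)
      then have "unity_char q (u * X z + v * Y z) = (\<Prod>p\<in>Pr. unity_char q (int (Q p) * (m p * (u * x p (z p) + v * y p (z p)))))"
        by (simp add: unity_char_sum)
      \<comment> \<open>As \<open>q = n p * Q p\<close>, a character modulo \<open>q\<close> at a
        multiple of \<open>Q p\<close> is a character modulo \<open>n p\<close>.\<close>
      also have "\<dots> = (\<Prod>p\<in>Pr. unity_char (n p) (m p * (u * x p (z p) + v * y p (z p))))"
        using unity_char_cancel[OF Q0] nQ by (metis (no_types, lifting))
      finally show "unity_char q (u * X z + v * Y z) = \<dots>" .
    qed
    also have "\<dots> = (\<Prod>p\<in>Pr. \<Sum>j\<in>J p. unity_char (n p) (m p * (u * x p j + v * y p j)))"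
      unfolding Z_def by (rule prod_sum_PiE[symmetric]) (use fin in \<open>auto simp: J_def\<close>)
    also have "\<dots> = (\<Prod>p\<in>Pr. of_real (real (card (J p)) * local_factor p (a p) (b p) (m p) (w p) u v))"
      unfolding x_def y_def J_def n_def by (intro prod.cong refl sum_unity_char_local p)
    also have "\<dots> = of_real ((\<Prod>p\<in>Pr. real (card (J p))) * (\<Prod>p\<in>Pr. local_factor p (a p) (b p) (m p) (w p) u v))"
      by (simp only: prod.distrib flip: of_real_prod)
    also have "(\<Prod>p\<in>Pr. real (card (J p))) = real (card Z)"
      using fin by (simp add: Z_def card_PiE)
    finally show "(\<Sum>z\<in>Z. unity_char q (u * X z + v * Y z)) =
      of_real (card Z * (\<Prod>p\<in>prime_factors q. local_factor p (multiplicity p q) (b p) (m p) (w p) u v))"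
      by (simp only: Pr_def a_def)
  qed
qed

section \<open>Choosing the exceptional primes\<close>

text \<open>For \<open>0 \<le> e \<le> 1\<close> the interval from \<open>- e\<close> to 1 is closed
  under multiplication.\<close>

lemma prod_ge_neg:
  fixes g :: "'a \<Rightarrow> real"
  assumes "0 \<le> e" "e \<le> 1" "\<And>p. p \<in> S \<Longrightarrow> - e \<le> g p \<and> g p \<le> 1"
  shows "- e \<le> prod g S \<and> prod g S \<le> 1"
  using assms(3)
proof (induction S rule: infinite_finite_induct)
  case (insert p S)
  then have x: "- e \<le> g p" "g p \<le> 1" and y: "- e \<le> prod g S" "prod g S \<le> 1"
    by auto
  have "- e \<le> g p * prod g S \<and> g p * prod g S \<le> 1"
  proof (cases "g p \<ge> 0")
    case True
    then have "g p * (- e) \<le> g p * prod g S" "g p * prod g S \<le> g p * 1"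
      using y by (intro mult_left_mono; simp)+
    moreover have "g p * e \<le> 1 * e"
      using x assms by (intro mult_right_mono) auto
    ultimately show ?thesis
      using x by simp
  next
    case False
    then have "g p * 1 \<le> g p * prod g S" "g p * prod g S \<le> g p * (- e)"
      using y by (intro mult_left_mono_neg; simp)+
    moreover have "- g p * e \<le> 1 * 1"
      using x assms by (intro mult_mono) auto
    ultimately show ?thesis
      using x by simp
  qed
  then show ?case
    using insert by simp
qed (use assms in auto)

text \<open>\<open>T\<close> maximises \<open>(\<Sum>x\<in>E. U x * (\<Prod>p\<in>N x - T. k p)) - \<gamma> * card T\<close>.\<close>

lemma selection:
  fixes U :: "'x \<Rightarrow> real" and N :: "'x \<Rightarrow> 'p set" and k :: "'p \<Rightarrow> real"
  assumes fin: "finite E" "finite M" "\<And>x. finite (N x)" and U: "\<And>x. U x \<ge> 0"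
    and k0: "\<And>x p. p \<in> N x \<Longrightarrow> 0 \<le> k p \<and> k p \<le> 1" and k2: "\<And>p. p \<in> M \<Longrightarrow> 0 \<le> k p \<and> k p \<le> 1 / 2"
  obtains T where "T \<subseteq> M" "\<gamma> * real (card T) \<le> (\<Sum>x\<in>E. U x)"
    "\<And>p. p \<in> M - T \<Longrightarrow> (\<Sum>x\<in>{x \<in> E. p \<in> N x}. U x * (\<Prod>p'\<in>N x - T. k p')) \<le> 2 * k p * \<gamma>"
proof -
  define \<Phi> where "\<Phi> T = (\<Sum>x\<in>E. U x * (\<Prod>p\<in>N x - T. k p))" for T
  define \<Psi> where "\<Psi> T = \<Phi> T - \<gamma> * real (card T)" for T
  have "Max (\<Psi> ` Pow M) \<in> \<Psi> ` Pow M"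
    using fin by (intro Max_in) auto
  then obtain T where T: "T \<subseteq> M" "\<Psi> T = Max (\<Psi> ` Pow M)"
    by auto
  have max: "\<Psi> T' \<le> \<Psi> T" if "T' \<subseteq> M" for T'
    unfolding T(2) using that fin by (intro Max_ge) auto
  have prod0: "0 \<le> (\<Prod>p\<in>N x - T. k p)" and prod1: "(\<Prod>p\<in>N x - T. k p) \<le> 1" for x T
    using k0 by (auto intro!: prod_nonneg prod_le_1)
  show ?thesis
  proof (rule that[OF T(1)])
    have "0 \<le> \<Phi> {}"
      unfolding \<Phi>_def by (intro sum_nonneg mult_nonneg_nonneg U prod0)
    then have "\<gamma> * real (card T) \<le> \<Phi> T"
      using max[of "{}"] by (simp add: \<Psi>_def)
    also have "\<dots> \<le> (\<Sum>x\<in>E. U x * 1)"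
      unfolding \<Phi>_def by (intro sum_mono mult_left_mono U prod1)
    finally show "\<gamma> * real (card T) \<le> (\<Sum>x\<in>E. U x)"
      by simp
  next
    fix p assume p: "p \<in> M - T"
    let ?P = "\<lambda>x. \<Prod>p'\<in>N x - insert p T. k p'"
    let ?E = "{x \<in> E. p \<in> N x}"
    have pr: "(\<Prod>p'\<in>N x - T. k p') = k p * ?P x" if "p \<in> N x" for x
    proof -
      have eq: "N x - T = insert p (N x - insert p T)"
        using that p by auto
      show ?thesis
        unfolding eq by (rule prod.insert) (use fin(3)[of x] in auto)
    qed
    have pr': "N x - insert p T = N x - T" if "p \<notin> N x" for x
      using that by auto
    \<comment> \<open>Adding \<open>p\<close> to \<open>T\<close> removes the factor
      \<open>k p\<close> wherever it occurs. By maximality this gains at most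
      \<open>\<gamma>\<close>, and \<open>1 - k p \<ge> 1 / 2\<close> turns the gain into a bound on
      the sum itself.\<close>
    have "card (insert p T) = Suc (card T)"
      using p T fin by (auto intro: card_insert_disjoint finite_subset)
    then have "\<Phi> (insert p T) - \<Phi> T \<le> \<gamma>"
      using max[of "insert p T"] p T by (simp add: \<Psi>_def algebra_simps)
    moreover have "\<Phi> (insert p T) - \<Phi> T = (\<Sum>x\<in>E. if p \<in> N x then (1 - k p) * (U x * ?P x) else 0)"
      unfolding \<Phi>_def sum_subtractf[symmetric]
      by (intro sum.cong) (auto simp: pr pr' algebra_simps)
    moreover have "\<dots> = (1 - k p) * (\<Sum>x\<in>?E. U x * ?P x)"
      unfolding sum_distrib_left sum.inter_filter[OF fin(1)] by (intro sum.cong) auto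
    ultimately have g: "(1 - k p) * (\<Sum>x\<in>?E. U x * ?P x) \<le> \<gamma>"
      by simp
    have "0 \<le> (\<Sum>x\<in>?E. U x * ?P x)"
      by (intro sum_nonneg mult_nonneg_nonneg U prod0)
    then have "1 / 2 * (\<Sum>x\<in>?E. U x * ?P x) \<le> (1 - k p) * (\<Sum>x\<in>?E. U x * ?P x)"
      using k2[of p] p by (intro mult_right_mono) auto
    then have "(\<Sum>x\<in>?E. U x * ?P x) \<le> 2 * \<gamma>"
      using g by linarith
    then have "k p * (\<Sum>x\<in>?E. U x * ?P x) \<le> k p * (2 * \<gamma>)"
      using k2[of p] p by (intro mult_left_mono) auto
    moreover have "(\<Sum>x\<in>?E. U x * (\<Prod>p'\<in>N x - T. k p')) = k p * (\<Sum>x\<in>?E. U x * ?P x)"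
      unfolding sum_distrib_left by (intro sum.cong) (auto simp: pr)
    ultimately show "(\<Sum>x\<in>?E. U x * (\<Prod>p'\<in>N x - T. k p')) \<le> 2 * k p * \<gamma>"
      by simp
  qed
qed

section \<open>The primorial bound\<close>

text \<open>By symmetry this binomial coefficient occurs twice in a row with sum
  \<open>2 ^ (2 * m + 1)\<close>.\<close>

lemma binomial_odd_le: "(2 * m + 1) choose m \<le> 4 ^ m"
proof -
  have sym: "(2 * m + 1) choose (m + 1) = (2 * m + 1) choose m"
    using binomial_symmetric[of m "2 * m + 1"] by simp
  have "2 * ((2 * m + 1) choose m) = (\<Sum>k\<in>{m, m + 1}. (2 * m + 1) choose k)"
    using sym by simp
  also have "\<dots> \<le> (\<Sum>k\<le>2 * m + 1. (2 * m + 1) choose k)"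
    by (intro sum_mono2) auto
  also have "\<dots> = 2 ^ (2 * m + 1)"
    by (rule choose_row_sum)
  also have "\<dots> = 2 * 4 ^ m"
    by (simp add: power_mult)
  finally show ?thesis
    by simp
qed

lemma prod_primes_dvd:
  fixes n :: nat
  assumes "finite S" "\<And>p. p \<in> S \<Longrightarrow> prime p \<and> p dvd n"
  shows "(\<Prod>p\<in>S. p) dvd n"
  using assms
proof (induction S rule: finite_induct)
  case (insert p S)
  have "coprime p (\<Prod>p\<in>S. p)"
    using insert by (intro prod_coprime_right) (auto intro!: primes_coprime)
  then show ?case
    using insert by (simp add: divides_mult)
qed simp

text \<open>The argument of Erdos: for \<open>n = 2 * m + 1\<close> the primes between
  \<open>m + 2\<close> and \<open>n\<close> all divide \<open>n choose m\<close>, and induction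
  covers those up to \<open>m + 1\<close>. An even \<open>n > 2\<close> is not prime and adds
  nothing.\<close>

lemma primorial_le: "(\<Prod>p | prime p \<and> p \<le> n. p) \<le> (4::nat) ^ n"
proof (induction n rule: less_induct)
  case (less n)
  consider "n \<le> 2" | m where "n = 2 * m + 1" "m \<ge> 1" | m where "n = 2 * m + 2" "m \<ge> 1"
  proof -
    assume *: "n \<le> 2 \<Longrightarrow> thesis" "\<And>m. n = 2 * m + 1 \<Longrightarrow> m \<ge> 1 \<Longrightarrow> thesis"
      "\<And>m. n = 2 * m + 2 \<Longrightarrow> m \<ge> 1 \<Longrightarrow> thesis"
    show thesis
    proof (cases "n \<le> 2")
      case False
      then show ?thesis
        using *(2)[of "n div 2"] *(3)[of "n div 2 - 1"] by (cases "even n") (auto elim!: evenE oddE)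
    qed (rule *(1))
  qed
  then show ?case
  proof cases
    case 1
    have "{p. prime p \<and> p \<le> n} \<subseteq> {2}"
      using 1 by (auto dest: prime_ge_2_nat)
    then consider "{p. prime p \<and> p \<le> n} = {}" | "{p. prime p \<and> p \<le> n} = {2}"
      by auto
    then show ?thesis
    proof cases
      case 1
      show ?thesis
        unfolding 1 by simp
    next
      case 2
      then have "2 \<in> {p. prime p \<and> p \<le> n}"
        by blast
      then have "n = 2"
        using 1 by simp
      then show ?thesis
        using 2 by simp
    qed
  next
    case (2 m)
    let ?A = "{p. prime p \<and> p \<le> m + 1}" and ?B = "{p. prime p \<and> m + 1 < p \<and> p \<le> n}"
    have "(\<Prod>p\<in>?B. p) dvd n choose m"
    proof (rule prod_primes_dvd)
      fix p assume p: "p \<in> ?B"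
      have "fact m * fact (n - m) * (n choose m) = fact n"
        using 2 by (intro binomial_fact_lemma) simp
      moreover have "p dvd fact n"
        using p by (simp add: prime_dvd_fact_iff)
      ultimately have "p dvd fact m * fact (n - m) * (n choose m)"
        by simp
      moreover have "\<not> p dvd fact m" "\<not> p dvd fact (n - m)"
        using p 2 prime_dvd_fact_iff[of p m] prime_dvd_fact_iff[of p "n - m"] by auto
      ultimately show "prime p \<and> p dvd n choose m"
        using p by (simp add: prime_dvd_mult_iff)
    qed simp
    then have "(\<Prod>p\<in>?B. p) \<le> n choose m"
      using 2 by (intro dvd_imp_le) auto
    also have "\<dots> \<le> 4 ^ m"
      unfolding 2 by (rule binomial_odd_le)
    finally have "(\<Prod>p\<in>?A. p) * (\<Prod>p\<in>?B. p) \<le> 4 ^ (m + 1) * 4 ^ m"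
      using 2 by (intro mult_mono less.IH) auto
    also have "(\<Prod>p\<in>?A. p) * (\<Prod>p\<in>?B. p) = (\<Prod>p\<in>?A \<union> ?B. p)"
      by (rule prod.union_disjoint[symmetric]) auto
    also have "?A \<union> ?B = {p. prime p \<and> p \<le> n}"
      using 2 by auto
    finally show ?thesis
      using 2 by (simp add: mult_2 power_add)
  next
    case (3 m)
    have "\<not> prime n"
      using 3 prime_odd_nat[of n] by auto
    then have "{p. prime p \<and> p \<le> n} = {p. prime p \<and> p \<le> n - 1}"
      by (auto simp: le_less intro: ccontr)
    then show ?thesis
      using less.IH[of "n - 1"] 3 by simp
  qed
qed

section \<open>Fourier analysis of difference sets\<close>

text \<open>The squared modulus of the Fourier transform of the indicator of \<open>A\<close>, which
  is the transform of the representation count of differences in \<open>A\<close>.\<close>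

definition spec :: "nat \<Rightarrow> int set \<Rightarrow> int \<Rightarrow> real"
  where "spec q A x = (cmod (\<Sum>a\<in>A. unity_char q (x * a))) ^ 2"

lemma spec_nonneg: "spec q A x \<ge> 0"
  by (simp add: spec_def)

lemma spec_0: "spec q A 0 = real (card A) ^ 2"
  by (simp add: spec_def)

text \<open>Fourier inversion: the squared modulus expands over differences \<open>a - a'\<close>,
  and orthogonality keeps those congruent to \<open>- t\<close>.\<close>

lemma sum_spec_unity_char:
  assumes q: "q > 0" and A: "finite A"
  shows "(\<Sum>x\<in>{0..<int q}. of_real (spec q A x) * unity_char q (x * t)) =
    of_nat (q * card {(a, a'). a \<in> A \<and> a' \<in> A \<and> int q dvd a - a' + t})"
proof -
  have s: "of_real (spec q A x) = (\<Sum>(a, a')\<in>A \<times> A. unity_char q (x * a - x * a'))" for x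
  proof -
    have "of_real (spec q A x) = (\<Sum>a\<in>A. unity_char q (x * a)) * cnj (\<Sum>a\<in>A. unity_char q (x * a))"
      unfolding spec_def by (rule complex_norm_square)
    also have "\<dots> = (\<Sum>a\<in>A. unity_char q (x * a)) * (\<Sum>a\<in>A. unity_char q (- (x * a)))"
      by (simp add: cnj_unity_char)
    also have "\<dots> = (\<Sum>(a, a')\<in>A \<times> A. unity_char q (x * a - x * a'))"
      by (simp add: sum_product sum.cartesian_product flip: unity_char_add)
    finally show ?thesis .
  qed
  have "(\<Sum>x\<in>{0..<int q}. of_real (spec q A x) * unity_char q (x * t)) =
      (\<Sum>x\<in>{0..<int q}. \<Sum>g\<in>A \<times> A. unity_char q (x * (fst g - snd g + t)))"
    unfolding s sum_distrib_right
    by (intro sum.cong) (auto simp: case_prod_unfold algebra_simps simp flip: unity_char_add)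
  also have "\<dots> = (\<Sum>g\<in>A \<times> A. \<Sum>x\<in>{0..<int q}. unity_char q (x * (fst g - snd g + t)))"
    by (rule sum.swap)
  also have "\<dots> = (\<Sum>g\<in>A \<times> A. if int q dvd fst g - snd g + t then of_nat q else 0)"
    by (simp add: sum_unity_char[OF q])
  also have "\<dots> = (\<Sum>g\<in>{g \<in> A \<times> A. int q dvd fst g - snd g + t}. of_nat q)"
    using A by (intro sum.inter_filter[symmetric]) auto
  also have "{g \<in> A \<times> A. int q dvd fst g - snd g + t} =
      {(a, a'). a \<in> A \<and> a' \<in> A \<and> int q dvd a - a' + t}"
    by auto
  finally show ?thesis
    by (simp add: mult.commute)
qed

text \<open>Parseval's identity, the case \<open>t = 0\<close>: elements of \<open>A\<close> are
  distinct modulo \<open>q\<close>, so only \<open>a = a'\<close> remains.\<close>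

lemma sum_spec:
  assumes q: "q > 0" and A: "A \<subseteq> {0..<int q}"
  shows "(\<Sum>x\<in>{0..<int q}. spec q A x) = real q * real (card A)"
proof -
  have fin: "finite A"
    using A by (rule finite_subset) simp
  have "{(a, a'). a \<in> A \<and> a' \<in> A \<and> int q dvd a - a' + 0} = (\<lambda>a. (a, a)) ` A"
    using A by (auto simp: subset_iff cong_iff_dvd_diff[symmetric] intro: cong_less_imp_eq_int)
  then have "card {(a, a'). a \<in> A \<and> a' \<in> A \<and> int q dvd a - a' + 0} = card A"
    by (simp add: card_image inj_on_def)
  then have "complex_of_real (\<Sum>x\<in>{0..<int q}. spec q A x) = of_real (real q * real (card A))"
    using sum_spec_unity_char[OF q fin, of 0] by simp
  then show ?thesis
    by (simp only: of_real_eq_iff)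
qed

text \<open>Inserting the character sum for \<open>F\<close> and inverting turns the expression in
  \<open>pos\<close> into a sum over \<open>z\<close> of products of representation counts at
  \<open>X z\<close> and \<open>t * Y z\<close>. If it is nonzero, some product is.\<close>

lemma ex_differences:
  fixes F :: "int \<Rightarrow> int \<Rightarrow> real"
  assumes q: "q > 0" and fin: "finite A" "finite B" "finite Z"
    and F: "\<And>x y. (\<Sum>z\<in>Z. unity_char q (x * X z + y * Y z)) = of_real (real (card Z) * F x y)"
    and pos: "real (card Z) * (\<Sum>x\<in>{0..<int q}. \<Sum>y\<in>{0..<int q}. spec q A x * spec q B y * F x (t * y)) \<noteq> 0"
  shows "\<exists>z\<in>Z. \<exists>a\<in>A. \<exists>a'\<in>A. \<exists>b\<in>B. \<exists>b'\<in>B. int q dvd a - a' + X z \<and> int q dvd b - b' + t * Y z"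
proof (rule ccontr)
  assume neg: "\<not> ?thesis"
  define r where "r A s = card {(a, a'). a \<in> A \<and> a' \<in> A \<and> int q dvd a - a' + s}" for A s
  let ?I = "{0..<int q}"
  have r0: "r A (X z) = 0 \<or> r B (t * Y z) = 0" if "z \<in> Z" for z
  proof -
    have "{(a, a'). a \<in> A \<and> a' \<in> A \<and> int q dvd a - a' + X z} = {} \<or>
      {(a, a'). a \<in> B \<and> a' \<in> B \<and> int q dvd a - a' + t * Y z} = {}"
      using neg that by blast
    then show ?thesis
      by (elim disjE) (simp_all only: r_def card.empty simp_thms)
  qed
  have "of_real (real (card Z) * (\<Sum>x\<in>?I. \<Sum>y\<in>?I. spec q A x * spec q B y * F x (t * y))) =
      (\<Sum>x\<in>?I. \<Sum>y\<in>?I. of_real (spec q A x * spec q B y) * (\<Sum>z\<in>Z. unity_char q (x * X z + t * y * Y z)))"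
    unfolding F by (simp add: sum_distrib_left algebra_simps)
  also have "\<dots> = (\<Sum>x\<in>?I. \<Sum>y\<in>?I. \<Sum>z\<in>Z. (of_real (spec q A x) * unity_char q (x * X z)) *
      (of_real (spec q B y) * unity_char q (y * (t * Y z))))"
    unfolding sum_distrib_left by (intro sum.cong refl) (simp add: unity_char_add algebra_simps)
  also have "\<dots> = (\<Sum>x\<in>?I. \<Sum>z\<in>Z. \<Sum>y\<in>?I. (of_real (spec q A x) * unity_char q (x * X z)) *
      (of_real (spec q B y) * unity_char q (y * (t * Y z))))"
    by (intro sum.cong refl sum.swap)
  also have "\<dots> = (\<Sum>z\<in>Z. \<Sum>x\<in>?I. \<Sum>y\<in>?I. (of_real (spec q A x) * unity_char q (x * X z)) *
      (of_real (spec q B y) * unity_char q (y * (t * Y z))))"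
    by (rule sum.swap)
  also have "\<dots> = (\<Sum>z\<in>Z. (\<Sum>x\<in>?I. of_real (spec q A x) * unity_char q (x * X z)) *
      (\<Sum>y\<in>?I. of_real (spec q B y) * unity_char q (y * (t * Y z))))"
    by (simp only: sum_product)
  also have "\<dots> = (\<Sum>z\<in>Z. of_nat (q * r A (X z)) * of_nat (q * r B (t * Y z)))"
    unfolding r_def by (simp only: sum_spec_unity_char[OF q fin(1)] sum_spec_unity_char[OF q fin(2)])
  also have "\<dots> = 0"
    by (rule sum.neutral, intro ballI) (use r0 in fastforce)
  finally show False
    using pos by (simp only: of_real_eq_0_iff)
qed

section \<open>The spectral lower bound\<close>

lemma decay_le:
  assumes "c > 0" "real p \<ge> 16 / c ^ 4"
  shows "decay p \<le> c"
proof -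
  have "2 / c = sqrt (sqrt ((2 / c) ^ 4))"
  proof -
    have "(2 / c) ^ 4 = ((2 / c) ^ 2) ^ 2"
      by (subst power_mult[symmetric]) simp
    then show ?thesis
      using assms by (simp only: real_sqrt_abs) simp
  qed
  also have "\<dots> \<le> sqrt (sqrt (real p))"
    using assms by (intro real_sqrt_le_mono) (simp add: power_divide)
  finally have le: "2 / c \<le> sqrt (sqrt (real p))" .
  have "0 < 2 / c"
    using assms by simp
  then have "0 < sqrt (sqrt (real p))"
    using le by linarith
  moreover have "2 \<le> c * sqrt (sqrt (real p))"
    using le assms by (simp add: pos_divide_le_eq mult.commute)
  ultimately show ?thesis
    by (simp only: decay_def pos_divide_le_eq)
qed

text \<open>Read \<open>L\<close> as the large primes, and \<open>R\<close>, \<open>R'\<close> as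
  those at which the two frequencies are nontrivial. If both sets are empty,
  \<open>prod_ge_neg\<close> applies; if they differ, one factor of size at most \<open>e\<close>
  suffices; if they agree and are nonempty, the factors over \<open>R\<close> give the product of
  the \<open>k p\<close>.\<close>

lemma prod_factors_ge:
  fixes g :: "nat \<Rightarrow> real"
  assumes fin: "finite P" and e: "0 \<le> e" "e \<le> 1"
    and le1: "\<And>p. p \<in> P \<Longrightarrow> \<bar>g p\<bar> \<le> 1"
    and S: "\<And>p. p \<in> P - L \<Longrightarrow> g p \<ge> - e"
    and L: "L \<subseteq> P" "R \<subseteq> L" "R' \<subseteq> L"
    and g0: "\<And>p. p \<in> L \<Longrightarrow> p \<notin> R \<Longrightarrow> p \<notin> R' \<Longrightarrow> g p = 1"
    and g1: "\<And>p. p \<in> L \<Longrightarrow> (p \<in> R) \<noteq> (p \<in> R') \<Longrightarrow> \<bar>g p\<bar> \<le> e"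
    and g2: "\<And>p. p \<in> L \<Longrightarrow> p \<in> R \<Longrightarrow> p \<in> R' \<Longrightarrow> \<bar>g p\<bar> \<le> k p"
  shows "- e - (if R = R' \<and> R \<noteq> {} then \<Prod>p\<in>R. k p else 0) \<le> (\<Prod>p\<in>P. g p)"
proof -
  have k0: "k p \<ge> 0" if "p \<in> R" "R = R'" for p
  proof -
    have "\<bar>g p\<bar> \<le> k p"
      using g2[of p] L that by blast
    then show ?thesis
      by linarith
  qed
  have prod_le: "(\<Prod>p\<in>Q. \<bar>g p\<bar>) \<le> 1" if "Q \<subseteq> P" for Q
    using that le1 by (intro prod_le_1) auto
  consider "R = {}" "R' = {}" | "R \<noteq> R'" | "R = R'" "R \<noteq> {}"
    by blast
  then show ?thesis
  proof cases
    case 1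
    have "- e \<le> prod g P \<and> prod g P \<le> 1"
    proof (rule prod_ge_neg[OF e])
      fix p assume p: "p \<in> P"
      then show "- e \<le> g p \<and> g p \<le> 1"
        using le1[OF p] S[of p] g0[of p] 1 e by (cases "p \<in> L") auto
    qed
    then show ?thesis
      using 1 by simp
  next
    case 2
    then obtain p where p: "p \<in> L" "(p \<in> R) \<noteq> (p \<in> R')"
      using L by blast
    have "\<bar>prod g P\<bar> = \<bar>g p\<bar> * (\<Prod>p\<in>P - {p}. \<bar>g p\<bar>)"
      using p L fin by (subst prod.remove[of P p]) (auto simp: abs_mult abs_prod)
    also have "\<dots> \<le> e * 1"
      using g1[OF p] e prod_le[of "P - {p}"] by (intro mult_mono) (auto intro: prod_nonneg)
    finally show ?thesis
      using 2 by (auto simp: abs_le_iff)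
  next
    case 3
    have "\<bar>prod g P\<bar> = (\<Prod>p\<in>R. \<bar>g p\<bar>) * (\<Prod>p\<in>P - R. \<bar>g p\<bar>)"
      using L fin by (simp add: abs_prod abs_mult prod.subset_diff[of R P] mult.commute)
    also have "\<dots> \<le> (\<Prod>p\<in>R. k p) * 1"
    proof (rule mult_mono)
      show "(\<Prod>p\<in>R. \<bar>g p\<bar>) \<le> (\<Prod>p\<in>R. k p)"
        using g2 3 L by (intro prod_mono) auto
      show "0 \<le> (\<Prod>p\<in>R. k p)"
        using k0 3 by (intro prod_nonneg) auto
    qed (auto intro: prod_nonneg prod_le)
    finally show ?thesis
      using 3 e by (auto simp: abs_le_iff)
  qed
qed

text \<open>The origin contributes the main term \<open>U 0 * V 0\<close>. The loss \<open>e\<close>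
  is charged to the total mass. The loss \<open>k x\<close> arises only for
  \<open>R x = R (t * y)\<close>, so for each \<open>y\<close> it is controlled by \<open>B\<close>,
  uniformly in \<open>t\<close>.\<close>

lemma spectral_sum_pos:
  fixes U V :: "int \<Rightarrow> real" and R :: "int \<Rightarrow> 'p set" and k :: "int \<Rightarrow> real"
  assumes I: "finite I" "0 \<in> I" and UV: "\<And>x. U x \<ge> 0" "\<And>x. V x \<ge> 0"
    and e: "e \<ge> 0" and k: "\<And>x. k x \<ge> 0"
    and F: "\<And>x y. - e - (if R x = R y \<and> R x \<noteq> {} then k x else 0) \<le> F x y"
    and F0: "F 0 0 = 1" and R0: "R 0 = {}"
    and B: "B \<ge> 0" "\<And>y p. p \<in> R y \<Longrightarrow> (\<Sum>x\<in>{x \<in> I. p \<in> R x}. U x * k x) \<le> B"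
    and pos: "e * (\<Sum>x\<in>I. U x) * (\<Sum>y\<in>I. V y) + B * (\<Sum>y\<in>I. V y) < U 0 * V 0"
  shows "(\<Sum>x\<in>I. \<Sum>y\<in>I. U x * V y * F x (t * y)) > 0"
proof -
  define K where "K x y = (if R x = R (t * y) \<and> R x \<noteq> {} then U x * k x else 0)" for x y
  have K0: "K x y \<ge> 0" for x y
    using UV k by (simp add: K_def)
  define \<delta> where "\<delta> x = (if x = 0 then 1 else 0 :: real)" for x :: int
  have le: "(U x * \<delta> x) * (V y * \<delta> y) - e * (U x * V y) - V y * K x y \<le> U x * V y * F x (t * y)" for x y
  proof (cases "x = 0 \<and> y = 0")
    case True
    then show ?thesis
      using mult_nonneg_nonneg[OF e mult_nonneg_nonneg[OF UV(1)[of 0] UV(2)[of 0]]]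
        mult_nonneg_nonneg[OF UV(2)[of 0] K0[of 0 0]] F0 by (simp add: \<delta>_def)
  next
    case False
    have "U x * V y * (- e - (if R x = R (t * y) \<and> R x \<noteq> {} then k x else 0)) \<le> U x * V y * F x (t * y)"
      using UV by (intro mult_left_mono F) auto
    then show ?thesis
      using False by (auto simp: \<delta>_def K_def algebra_simps split: if_splits)
  qed
  have KB: "(\<Sum>x\<in>I. K x y) \<le> B" for y
  proof (cases "R (t * y) = {}")
    case True
    then show ?thesis
      using B by (simp add: K_def)
  next
    case False
    then obtain p where p: "p \<in> R (t * y)"
      by blast
    \<comment> \<open>Equality of the sets is weakened to sharing the single element
      \<open>p\<close>, so that the hypothesis on \<open>B\<close> applies.\<close>
    have "(\<Sum>x\<in>I. K x y) \<le> (\<Sum>x\<in>I. if p \<in> R x then U x * k x else 0)"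
      using p UV k by (intro sum_mono) (auto simp: K_def)
    also have "\<dots> = (\<Sum>x\<in>{x \<in> I. p \<in> R x}. U x * k x)"
      using I by (intro sum.inter_filter[symmetric])
    also have "\<dots> \<le> B"
      by (rule B(2)[OF p])
    finally show ?thesis .
  qed
  have "(\<Sum>x\<in>I. U x * \<delta> x) = U 0" "(\<Sum>y\<in>I. V y * \<delta> y) = V 0"
    using I by (simp_all add: \<delta>_def if_distrib cong: if_cong)
  then have s1: "(\<Sum>x\<in>I. \<Sum>y\<in>I. (U x * \<delta> x) * (V y * \<delta> y)) = U 0 * V 0"
    by (simp only: sum_product[symmetric])
  have s2: "(\<Sum>x\<in>I. \<Sum>y\<in>I. e * (U x * V y)) = e * ((\<Sum>x\<in>I. U x) * (\<Sum>y\<in>I. V y))"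
    unfolding sum_product by (simp only: sum_distrib_left)
  have s3: "(\<Sum>x\<in>I. \<Sum>y\<in>I. V y * K x y) = (\<Sum>y\<in>I. V y * (\<Sum>x\<in>I. K x y))"
    unfolding sum_distrib_left by (rule sum.swap)
  have "U 0 * V 0 - e * ((\<Sum>x\<in>I. U x) * (\<Sum>y\<in>I. V y)) - (\<Sum>y\<in>I. V y * (\<Sum>x\<in>I. K x y)) =
      (\<Sum>x\<in>I. \<Sum>y\<in>I. (U x * \<delta> x) * (V y * \<delta> y) - e * (U x * V y) - V y * K x y)"
    by (simp only: sum_subtractf s1 s2 s3)
  also have "\<dots> \<le> (\<Sum>x\<in>I. \<Sum>y\<in>I. U x * V y * F x (t * y))"
    by (intro sum_mono le)
  finally have "U 0 * V 0 - e * ((\<Sum>x\<in>I. U x) * (\<Sum>y\<in>I. V y)) - (\<Sum>y\<in>I. V y * (\<Sum>x\<in>I. K x y)) \<le>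
      (\<Sum>x\<in>I. \<Sum>y\<in>I. U x * V y * F x (t * y))" .
  moreover have "(\<Sum>y\<in>I. V y * (\<Sum>x\<in>I. K x y)) \<le> (\<Sum>y\<in>I. V y * B)"
    by (intro sum_mono mult_left_mono KB UV)
  moreover have "(\<Sum>y\<in>I. V y * B) = B * (\<Sum>y\<in>I. V y)"
    by (simp add: sum_distrib_left mult.commute)
  ultimately show ?thesis
    using pos by (simp add: mult.assoc)
qed

section \<open>Choice of the parameters and products of differences modulo \<open>q\<close>\<close>

text \<open>The selection of \<open>T\<close> uses only the spectrum of \<open>A\<close> and the two
  densities. It precedes \<open>t\<close>, so one product of prime powers serves all
  multiples.\<close>

lemma product_of_differences:
  fixes al be :: real
  assumes q: "q > 0" and A: "A \<subseteq> {0..<int q}" "A \<noteq> {}" and B: "B \<subseteq> {0..<int q}" "B \<noteq> {}"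
    and al: "real (card A) = al * real q" and be: "real (card B) = be * real q" and le: "be \<le> al"
  obtains T where "T \<subseteq> {p \<in> prime_factors q. 256 / be ^ 2 < real p \<and> real p \<le> 256 / be ^ 8}"
    "real (card T) \<le> 2 / sqrt be ^ 3"
    "\<And>t. \<exists>a\<in>A. \<exists>a'\<in>A. \<exists>b\<in>B. \<exists>b'\<in>B. [(a - a') * (b - b') = t * (\<Prod>p\<in>prime_factors q.
        int p ^ (if real p \<le> 256 / be ^ 2 \<or> p \<in> T then nat \<lceil>12 / be ^ 2\<rceil> else 0))] (mod int q)"
proof -
  have fin: "finite A" "finite B"
    using A B by (auto intro: finite_subset)
  have q0: "real q > 0"
    using q by simp
  have "card A > 0" "card B > 0"
    using A B fin by (auto simp: card_gt_0_iff)
  then have al0: "al > 0" and be0: "be > 0"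
    using al be q0 by (metis of_nat_0_less_iff zero_less_mult_pos2)+
  have "card A \<le> card {0..<int q}"
    using A by (intro card_mono) auto
  then have "al * real q \<le> 1 * real q"
    using al by simp
  then have al1: "al \<le> 1"
    using q0 by (simp only: mult_le_cancel_right_pos)
  then have be1: "be \<le> 1"
    using le by simp
  define s where "s = sqrt be"
  have s: "s > 0" "s \<le> 1" "be = s ^ 2"
    using be0 be1 by (auto simp: s_def)
  define Pr where "Pr = prime_factors q"
  define n where "n p = int (p ^ multiplicity p q)" for p
  define N where "N x = {p \<in> Pr. 256 / be ^ 2 < real p \<and> \<not> n p dvd x}" for x
  \<comment> \<open>The intermediate primes: beyond \<open>256 / be ^ 8\<close> the decay suffices
    by itself, and up to \<open>256 / be ^ 2\<close> every prime is treated as small.\<close>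
  define M where "M = {p \<in> Pr. 256 / be ^ 2 < real p \<and> real p \<le> 256 / be ^ 8}"
  define I where "I = {0..<int q}"
  define U where "U = spec q A"
  define V where "V = spec q B"
  \<comment> \<open>The price of one exceptional prime. As \<open>decay p \<le> s / 2\<close>, the
    loss \<open>2 * decay p * \<gamma>\<close> is at most \<open>Bd\<close> below. The mass
    \<open>al * real q ^ 2\<close> pays for at most \<open>2 / (al * s)\<close> primes, and
    \<open>al \<ge> s ^ 2\<close>.\<close>
  define \<gamma> where "\<gamma> = 1 / 2 * al ^ 2 * s * real q ^ 2"
  \<comment> \<open>Charged to the total mass, \<open>e\<close> costs at most a quarter of the main
    term, since \<open>be \<le> al\<close>. The exponent \<open>12 / be ^ 2\<close> at small primes
    is chosen so that \<open>3 / (12 / be ^ 2) = e\<close>.\<close>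
  define e where "e = be ^ 2 / 4"
  have e: "0 < e" "e \<le> 1"
    using be0 be1 power_le_one[of be 2] by (auto simp: e_def)
  have finPr: "finite Pr"
    by (simp add: Pr_def)
  have UV: "U x \<ge> 0" "V x \<ge> 0" for x
    by (simp_all add: U_def V_def spec_nonneg)
  have sumU: "(\<Sum>x\<in>I. U x) = al * real q ^ 2" and sumV: "(\<Sum>x\<in>I. V x) = be * real q ^ 2"
    using sum_spec[OF q A(1)] sum_spec[OF q B(1)] al be
    by (simp_all add: I_def U_def V_def power2_eq_square)
  have be2: "1 \<le> 1 / be ^ 2"
    using be0 be1 by (simp add: power_le_one)
  have big: "real p > 256" if "256 / be ^ 2 < real p" for p
    using that be2 by simp
  have kap0: "0 < decay p" if "256 / be ^ 2 < real p" for p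
    using big[OF that] by (intro decay_pos) simp
  \<comment> \<open>In \<open>decay_le\<close> the threshold is \<open>16 / c ^ 4\<close>. The
    values \<open>c = s / 2\<close> and \<open>c = be ^ 2 / 2\<close> produce the two cut-offs
    \<open>256 / be ^ 2\<close> and \<open>256 / be ^ 8\<close>.\<close>
  have kap1: "decay p \<le> s / 2" if "256 / be ^ 2 < real p" for p
    using that s by (intro decay_le) (auto simp: power_divide simp flip: power_mult)
  have kap2: "decay p \<le> be ^ 2 / 2" if "256 / be ^ 8 < real p" for p
    using that be0 by (intro decay_le) (auto simp: power_divide simp flip: power_mult)
  have kap3: "decay p \<le> 1 / 2" if "256 / be ^ 2 < real p" for p
    using kap1[OF that] s by simp
  obtain T where T: "T \<subseteq> M" "\<gamma> * real (card T) \<le> (\<Sum>x\<in>I. U x)"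
    "\<And>p. p \<in> M - T \<Longrightarrow> (\<Sum>x\<in>{x \<in> I. p \<in> N x}. U x * (\<Prod>p'\<in>N x - T. decay p')) \<le> 2 * decay p * \<gamma>"
  proof (rule selection[of I M N U decay \<gamma>])
    show "finite I" "finite M" "\<And>x. finite (N x)"
      using finPr by (auto simp: I_def M_def N_def)
    show "0 \<le> decay p \<and> decay p \<le> 1" if "p \<in> N x" for x p
      using that kap0[of p] kap3[of p] by (auto simp: N_def)
    show "0 \<le> decay p \<and> decay p \<le> 1 / 2" if "p \<in> M" for p
      using that kap0[of p] kap3[of p] by (auto simp: M_def)
  qed (use UV in auto)
  define small where "small p \<longleftrightarrow> real p \<le> 256 / be ^ 2 \<or> p \<in> T" for p
  define R where "R x = N x - T" for x
  define L where "L = {p \<in> Pr. \<not> small p}"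
  define K where "K x = (\<Prod>p\<in>R x. decay p)" for x
  have RL: "R x \<subseteq> L" for x
    by (auto simp: R_def N_def L_def small_def)
  have R: "p \<in> R x \<longleftrightarrow> \<not> n p dvd x" if "p \<in> L" for p x
    using that by (auto simp: R_def N_def L_def small_def)
  have kapL: "0 \<le> decay p" "decay p \<le> 1" if "p \<in> L" for p
    using that kap0[of p] kap3[of p] by (auto simp: L_def small_def)
  have K0: "K x \<ge> 0" for x
    unfolding K_def using RL kapL by (intro prod_nonneg) auto
  define b where "b p = (if real p \<le> 256 / be ^ 2 \<or> p \<in> T then nat \<lceil>12 / be ^ 2\<rceil> else 0)" for p
  obtain Z :: "(nat \<Rightarrow> nat \<times> int \<times> int) set" and X Y m w
    where Z: "finite Z" "Z \<noteq> {}"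
    and XY: "\<And>z. z \<in> Z \<Longrightarrow> [X z * Y z = (\<Prod>p\<in>prime_factors q. int p ^ b p)] (mod int q)"
    and mw: "\<And>p. p \<in> prime_factors q \<Longrightarrow> \<not> int p dvd m p \<and> \<not> int p dvd w p"
    and F: "\<And>x y. (\<Sum>z\<in>Z. unity_char q (x * X z + y * Y z)) =
      of_real (card Z * (\<Prod>p\<in>prime_factors q. local_factor p (multiplicity p q) (b p) (m p) (w p) x y))"
    using product_family[OF q, of b] by blast
  define g where "g x y p = local_factor p (multiplicity p q) (b p) (m p) (w p) x y" for x y p
  define F' where "F' x y = (\<Prod>p\<in>Pr. g x y p)" for x y
  have F': "(\<Sum>z\<in>Z. unity_char q (x * X z + y * Y z)) = of_real (real (card Z) * F' x y)" for x y
    unfolding F F'_def g_def Pr_def ..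
  have cardZ: "real (card Z) > 0"
    using Z by (simp add: card_gt_0_iff)
  have F'0: "F' 0 0 = 1"
  proof -
    have "complex_of_real (real (card Z)) = of_real (real (card Z) * F' 0 0)"
      using F'[of 0 0] by simp
    then have "real (card Z) = real (card Z) * F' 0 0"
      by (simp only: of_real_eq_iff)
    then show ?thesis
      using cardZ by simp
  qed
  have p: "prime p" "multiplicity p q \<ge> 1" if "p \<in> Pr" for p
    using that q by (auto simp: Pr_def in_prime_factors_iff
        intro!: Suc_leI prime_multiplicity_gt_zero_iff[THEN iffD2])
  have F_ge: "- e - (if R x = R y \<and> R x \<noteq> {} then K x else 0) \<le> F' x y" for x y
    unfolding F'_def K_def
  proof (rule prod_factors_ge[OF finPr _ _ _ _ _ RL RL])
    show "0 \<le> e" "e \<le> 1"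
      using e by auto
    show "L \<subseteq> Pr"
      by (auto simp: L_def)
    fix p
    show "\<bar>g x y p\<bar> \<le> 1" if "p \<in> Pr"
      unfolding g_def using that p mw by (intro local_factor_bounds) (auto simp: Pr_def)
    show "g x y p \<ge> - e" if "p \<in> Pr - L"
    proof -
      have "b p = nat \<lceil>12 / be ^ 2\<rceil>"
        using that by (auto simp: L_def small_def b_def)
      then have "12 / be ^ 2 \<le> real (b p) + 1"
        by linarith
      then have "3 / (real (b p) + 1) \<le> 3 / (12 / be ^ 2)"
        using be0 by (intro divide_left_mono) auto
      also have "\<dots> = e"
        by (simp add: e_def)
      finally have "- e \<le> - 3 / (real (b p) + 1)"
        by simp
      also have "\<dots> \<le> g x y p"
        unfolding g_def using that p mw by (intro local_factor_bounds) (auto simp: Pr_def)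
      finally show ?thesis .
    qed
    assume pL: "p \<in> L"
    then have b0: "b p = 0" and pPr: "p \<in> Pr" and bigp: "256 / be ^ 2 < real p"
      by (auto simp: L_def small_def b_def)
    have p3: "p \<ge> 3"
      using big[OF bigp] by simp
    note l0 = local_factor_0_bounds[OF p[OF pPr] p3, of "m p" "w p" x y]
    have mwp: "\<not> int p dvd m p" "\<not> int p dvd w p"
      using mw pPr by (auto simp: Pr_def)
    note Rp = R[OF pL, of x] R[OF pL, of y]
    show "g x y p = 1" if "p \<notin> R x" "p \<notin> R y"
      using that l0(1)[OF mwp] Rp by (simp add: g_def b0 n_def)
    show "\<bar>g x y p\<bar> \<le> decay p" if "p \<in> R x" "p \<in> R y"
      using that l0(3)[OF mwp] Rp by (simp add: g_def b0 n_def)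
    show "\<bar>g x y p\<bar> \<le> e" if "(p \<in> R x) \<noteq> (p \<in> R y)"
    proof -
      have "\<bar>g x y p\<bar> \<le> 1 / (real p - 1)"
        using that l0(2)[OF mwp] Rp by (simp add: g_def b0 n_def)
      also have "\<dots> \<le> 1 / (4 / be ^ 2)"
      proof (rule divide_left_mono)
        \<comment> \<open>Splitting off 4 leaves at least 252, which absorbs the 1 subtracted from
          \<open>p\<close>.\<close>
        have "256 / be ^ 2 = 252 * (1 / be ^ 2) + 4 / be ^ 2"
          by simp
        then show "4 / be ^ 2 \<le> real p - 1"
          using bigp be2 by linarith
        then show "0 < (real p - 1) * (4 / be ^ 2)"
          using be0 p3 by (intro mult_pos_pos) auto
      qed simp
      also have "\<dots> = e"
        by (simp add: e_def)
      finally show ?thesis .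
    qed
  qed
  \<comment> \<open>Multiplied by the mass of \<open>B\<close> this is half of the main term
    \<open>U 0 * V 0\<close>; together with the quarter lost through \<open>e\<close> the total
    stays below it.\<close>
  define Bd where "Bd = 1 / 2 * al ^ 2 * be * real q ^ 2"
  have XB: "(\<Sum>x\<in>{x \<in> I. p \<in> R x}. U x * K x) \<le> Bd" if pR: "p \<in> R y" for y p
  proof -
    have pL: "p \<in> L"
      using RL pR by auto
    have eq: "{x \<in> I. p \<in> R x} = {x \<in> I. p \<in> N x}"
      using pL by (auto simp: R_def L_def small_def)
    show ?thesis
    proof (cases "real p \<le> 256 / be ^ 8")
      case True
      then have pM: "p \<in> M - T" and bigp: "256 / be ^ 2 < real p"
        using pL by (auto simp: L_def M_def small_def)
      have "(\<Sum>x\<in>{x \<in> I. p \<in> R x}. U x * K x) \<le> 2 * decay p * \<gamma>"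
        unfolding eq unfolding K_def R_def by (rule T(3)[OF pM])
      also have "\<dots> \<le> 2 * (s / 2) * \<gamma>"
        using kap1[OF bigp] s by (intro mult_right_mono) (auto simp: \<gamma>_def)
      also have "\<dots> = Bd"
        by (simp add: \<gamma>_def Bd_def s(3) power2_eq_square)
      finally show ?thesis .
    next
      case False
      \<comment> \<open>Beyond the upper cut-off the single factor \<open>decay p\<close> is small
        enough against the whole mass of \<open>A\<close>; the remaining factors are bounded by
        1.\<close>
      have "(\<Sum>x\<in>{x \<in> I. p \<in> R x}. U x * K x) \<le> (\<Sum>x\<in>{x \<in> I. p \<in> R x}. U x * decay p)"
      proof (intro sum_mono mult_left_mono UV)
        fix x assume "x \<in> {x \<in> I. p \<in> R x}"
        then have "p \<in> R x" by simp
        moreover have finR: "finite (R x)"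
          using finPr by (simp add: R_def N_def)
        ultimately have "K x = decay p * (\<Prod>p\<in>R x - {p}. decay p)"
          unfolding K_def by (intro prod.remove) auto
        also have "\<dots> \<le> decay p * 1"
          using RL kapL pL by (intro mult_left_mono prod_le_1) auto
        finally show "K x \<le> decay p" by simp
      qed
      also have "\<dots> \<le> (\<Sum>x\<in>I. U x * decay p)"
        using UV kapL[OF pL] by (intro sum_mono2) (auto simp: I_def)
      also have "\<dots> = al * real q ^ 2 * decay p"
        by (simp add: sumU flip: sum_distrib_right)
      also have "\<dots> \<le> al * real q ^ 2 * (al * be / 2)"
      proof (rule mult_left_mono)
        have "decay p \<le> be ^ 2 / 2"
          using False by (intro kap2) simp
        also have "be ^ 2 \<le> al * be"
          using le be0 by (simp add: power2_eq_square)
        finally show "decay p \<le> al * be / 2"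
          by simp
      qed (use al0 in simp)
      also have "\<dots> = Bd"
        by (simp add: Bd_def power2_eq_square)
      finally show ?thesis .
    qed
  qed
  have pos: "(\<Sum>x\<in>I. \<Sum>y\<in>I. U x * V y * F' x (t * y)) > 0" for t
  proof (rule spectral_sum_pos[where R = R and k = K and e = e and B = Bd])
    show "finite I" "0 \<in> I"
      using q by (auto simp: I_def)
    show "R 0 = {}"
      by (simp add: R_def N_def)
    show "e * (\<Sum>x\<in>I. U x) * (\<Sum>y\<in>I. V y) + Bd * (\<Sum>y\<in>I. V y) < U 0 * V 0"
    proof -
      define W where "W = al ^ 2 * be ^ 2 * real q ^ 4"
      have W0: "W > 0"
        using al0 be0 q0 by (simp add: W_def)
      have "e * (\<Sum>x\<in>I. U x) * (\<Sum>y\<in>I. V y) = 1 / 4 * (be * be) * (al * be * real q ^ 4)"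
        unfolding sumU sumV by (simp add: e_def power2_eq_square power4_eq_xxxx)
      also have "\<dots> \<le> 1 / 4 * (al * be) * (al * be * real q ^ 4)"
        using le be0 al0 by (intro mult_right_mono mult_left_mono) auto
      also have "\<dots> = 1 / 4 * W"
        by (simp add: W_def power2_eq_square)
      finally have "e * (\<Sum>x\<in>I. U x) * (\<Sum>y\<in>I. V y) \<le> 1 / 4 * W" .
      moreover have "Bd * (\<Sum>y\<in>I. V y) = 1 / 2 * W"
        unfolding sumV by (simp add: Bd_def W_def power2_eq_square power4_eq_xxxx)
      moreover have "U 0 * V 0 = W"
        by (simp add: U_def V_def spec_0 al be W_def power_mult_distrib power2_eq_square power4_eq_xxxx)
      ultimately show ?thesis
        using W0 by simp
    qed
    show "0 \<le> Bd"
      using be0 by (simp add: Bd_def)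
  qed (use e UV K0 F_ge F'0 XB in auto)
  show ?thesis
  proof (rule that)
    show "T \<subseteq> {p \<in> prime_factors q. 256 / be ^ 2 < real p \<and> real p \<le> 256 / be ^ 8}"
      using T(1) by (simp add: M_def Pr_def)
    have "\<gamma> * real (card T) \<le> al * real q ^ 2"
      using T(2) sumU by simp
    then have "(al * real q ^ 2) * (1 / 2 * al * s * real (card T)) \<le> (al * real q ^ 2) * 1"
      by (simp add: \<gamma>_def power2_eq_square mult_ac)
    moreover have "al * real q ^ 2 > 0"
      using al0 q0 by simp
    ultimately have "1 / 2 * al * s * real (card T) \<le> 1"
      by (simp only: mult_le_cancel_left_pos)
    moreover have "be * s * real (card T) \<le> al * s * real (card T)"
      using le s by (intro mult_right_mono) auto
    ultimately have "s ^ 3 * real (card T) \<le> 2"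
      using s(3) by (simp add: power2_eq_square power3_eq_cube mult_ac)
    then show "real (card T) \<le> 2 / sqrt be ^ 3"
      using s(1) by (simp add: field_simps flip: s_def)
    fix t
    have "real (card Z) * (\<Sum>x\<in>{0..<int q}. \<Sum>y\<in>{0..<int q}. spec q A x * spec q B y * F' x (t * y)) \<noteq> 0"
      using pos[of t] cardZ by (simp add: I_def U_def V_def)
    from ex_differences[OF q fin Z(1) F' this]
    obtain z a a' b1 b1' where z: "z \<in> Z" "a \<in> A" "a' \<in> A" "b1 \<in> B" "b1' \<in> B"
      "int q dvd a - a' + X z" "int q dvd b1 - b1' + t * Y z"
      by blast
    have "[a' - a = X z] (mod int q)" "[b1' - b1 = t * Y z] (mod int q)"
      using z(6,7) by (simp_all add: cong_iff_dvd_diff dvd_diff_commute algebra_simps)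
    then have "[(a' - a) * (b1' - b1) = X z * (t * Y z)] (mod int q)"
      by (rule cong_mult)
    also have "X z * (t * Y z) = t * (X z * Y z)"
      by simp
    also have "[t * (X z * Y z) = t * (\<Prod>p\<in>prime_factors q. int p ^ b p)] (mod int q)"
      by (intro cong_scalar_left XY z)
    finally show "\<exists>a\<in>A. \<exists>a'\<in>A. \<exists>b\<in>B. \<exists>b'\<in>B. [(a - a') * (b - b') = t * (\<Prod>p\<in>prime_factors q.
        int p ^ (if real p \<le> 256 / be ^ 2 \<or> p \<in> T then nat \<lceil>12 / be ^ 2\<rceil> else 0))] (mod int q)"
      using z unfolding b_def by blast
  qed
qed

section \<open>The size of the divisor\<close>

text \<open>Apply \<open>ln y \<le> y - 1\<close> to the square root. The exceptional primes number
  at most order \<open>be powr (- 3/2)\<close>, so a logarithm of order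
  \<open>be powr (- 1/2)\<close> keeps their contribution within order
  \<open>be powr (- 2)\<close>.\<close>

lemma ln_le_2_sqrt:
  assumes "x > 0"
  shows "ln x \<le> 2 * sqrt x"
proof -
  have "ln x = ln (sqrt x ^ 2)"
    using assms by simp
  also have "\<dots> = 2 * ln (sqrt x)"
    using assms by (subst ln_realpow) auto
  also have "ln (sqrt x) \<le> sqrt x - 1"
    using assms by (intro ln_le_minus_one) simp
  finally show ?thesis
    by simp
qed

text \<open>On the logarithmic scale the primorial bound gives \<open>512 / be ^ 2\<close> for the
  small primes, and the count of \<open>T\<close> gives \<open>48 / be ^ 2\<close>. The common
  exponent is at most \<open>13 / be ^ 2\<close>, and \<open>13 * 560 = 7280\<close>.\<close>

lemma divisor_bound:
  fixes be :: real
  assumes be: "0 < be" "be \<le> 1" and fin: "finite P" "\<And>p. p \<in> P \<Longrightarrow> prime p"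
    and T: "T \<subseteq> {p \<in> P. 256 / be ^ 2 < real p \<and> real p \<le> 256 / be ^ 8}"
      "real (card T) \<le> 2 / sqrt be ^ 3"
  shows "real (\<Prod>p\<in>P. p ^ (if real p \<le> 256 / be ^ 2 \<or> p \<in> T then nat \<lceil>12 / be ^ 2\<rceil> else 0))
    \<le> exp (8000 / be ^ 4)"
proof -
  define c where "c = nat \<lceil>12 / be ^ 2\<rceil>"
  define S where "S = {p \<in> P. real p \<le> 256 / be ^ 2}"
  define s where "s = sqrt be"
  have s: "s > 0" "s \<le> 1" "be = s ^ 2"
    using be by (auto simp: s_def)
  have be2: "1 \<le> 1 / be ^ 2"
    using be by (simp add: power_le_one)
  \<comment> \<open>Rounding up costs at most 1, which is at most \<open>1 / be ^ 2\<close>.\<close>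
  have c: "real c \<le> 13 / be ^ 2"
  proof -
    have "real c \<le> 12 / be ^ 2 + 1"
      unfolding c_def using be by (simp add: of_nat_nat)
    then show ?thesis
      using be2 by simp
  qed
  have finT: "finite T" "finite S"
    using T fin by (auto simp: S_def intro: finite_subset)
  have disj: "S \<inter> T = {}" "S \<union> T \<subseteq> P"
    using T by (auto simp: S_def)
  have pos: "p > 0" if "p \<in> P" for p
    using fin(2)[OF that] by (rule prime_gt_0_nat)
  have lnS: "ln (real (\<Prod>p\<in>S. p)) \<le> 512 / be ^ 2"
  proof -
    define k where "k = nat \<lfloor>256 / be ^ 2\<rfloor>"
    have k: "real k \<le> 256 / be ^ 2"
      unfolding k_def by simp
    have "S \<subseteq> {p. prime p \<and> p \<le> k}"
      using fin be by (auto simp: S_def k_def le_nat_floor)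
    then have "(\<Prod>p\<in>S. p) dvd (\<Prod>p | prime p \<and> p \<le> k. p)"
      by (intro prod_dvd_prod_subset) auto
    then have "(\<Prod>p\<in>S. p) \<le> (\<Prod>p | prime p \<and> p \<le> k. p)"
      by (rule dvd_imp_le) (auto intro!: prod_pos simp: prime_gt_0_nat)
    also have "\<dots> \<le> 4 ^ k"
      by (rule primorial_le)
    finally have "real (\<Prod>p\<in>S. p) \<le> real (4 ^ k)"
      by (simp only: of_nat_le_iff)
    then have "ln (real (\<Prod>p\<in>S. p)) \<le> ln (4 ^ k)"
      using pos by (subst ln_le_cancel_iff) (auto simp: S_def intro!: prod_pos)
    also have "\<dots> = real k * ln 4"
      by (simp add: ln_realpow)
    also have "ln 4 \<le> (2::real)"
    proof -
      have "ln (4::real) = 2 * ln 2"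
        using ln_realpow[of "2::real" 2] by simp
      also have "ln (2::real) \<le> 1"
        using ln_le_minus_one[of "2::real"] by simp
      finally show ?thesis by simp
    qed
    then have "real k * ln 4 \<le> 256 / be ^ 2 * 2"
      using k by (intro mult_mono) auto
    finally show ?thesis by simp
  qed
  have lnT: "ln (real (\<Prod>p\<in>T. p)) \<le> 48 / be ^ 2"
  proof -
    \<comment> \<open>From \<open>256 / be ^ 8 = (2 / be) ^ 8\<close>, the bound
      \<open>ln x \<le> 2 * sqrt x\<close> and \<open>sqrt 2 \<le> 3 / 2\<close>:
      \<open>8 * 2 * (3 / 2) = 24\<close>.\<close>
    define l where "l = 24 / s"
    have "ln (real (\<Prod>p\<in>T. p)) = (\<Sum>p\<in>T. ln (real p))"
      unfolding of_nat_prod using finT T pos by (intro ln_prod) auto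
    also have "\<dots> \<le> (\<Sum>p\<in>T. l)"
    proof (rule sum_mono)
      fix p assume p: "p \<in> T"
      then have "ln (real p) \<le> ln (256 / be ^ 8)"
        using T pos be by (subst ln_le_cancel_iff) auto
      also have "256 / be ^ 8 = (2 / be) ^ 8"
        by (simp add: power_divide)
      also have "ln ((2 / be) ^ 8) = 8 * ln (2 / be)"
        using be by (simp add: ln_realpow)
      also have "\<dots> \<le> 8 * (2 * sqrt (2 / be))"
        using be by (intro mult_left_mono ln_le_2_sqrt) auto
      also have "sqrt (2 / be) \<le> 3 / 2 / s"
      proof -
        have "sqrt 2 \<le> 3 / (2::real)"
          by (rule real_le_lsqrt) (auto simp: power2_eq_square)
        then show ?thesis
          unfolding s_def real_sqrt_divide using be by (intro divide_right_mono) auto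
      qed
      finally show "ln (real p) \<le> l"
        by (simp add: l_def)
    qed
    also have "\<dots> = real (card T) * l"
      by simp
    also have "\<dots> \<le> 2 / s ^ 3 * l"
      using T(2)[folded s_def] s(1) by (intro mult_right_mono) (simp_all add: l_def)
    also have "\<dots> = 48 / be ^ 2"
      unfolding s(3) l_def by (simp add: power2_eq_square power3_eq_cube)
    finally show ?thesis .
  qed
  have ST: "real (\<Prod>p\<in>S. p) > 0" "real (\<Prod>p\<in>T. p) > 0"
    using disj pos by (auto intro!: prod_pos)
  have "(\<Prod>p\<in>P. p ^ (if real p \<le> 256 / be ^ 2 \<or> p \<in> T then c else 0)) = (\<Prod>p\<in>S \<union> T. p ^ c)"
    using fin disj by (intro prod.mono_neutral_cong_right) (auto simp: S_def)
  also have "\<dots> = ((\<Prod>p\<in>S. p) * (\<Prod>p\<in>T. p)) ^ c"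
    using finT disj by (simp add: prod.union_disjoint prod_power_distrib power_mult_distrib)
  finally have eq: "real (\<Prod>p\<in>P. p ^ (if real p \<le> 256 / be ^ 2 \<or> p \<in> T then c else 0)) =
      (real (\<Prod>p\<in>S. p) * real (\<Prod>p\<in>T. p)) ^ c"
    by (simp only: of_nat_power of_nat_mult)
  have le_exp: "x \<le> exp y" if "ln x \<le> y" "x > 0" for x y :: real
    using that by (metis exp_le_cancel_iff exp_ln)
  have ln_mult_pos: "ln (x * y) = ln x + ln y" if "x > 0" "y > 0" for x y :: real
    using that by (simp add: ln_mult)
  have "ln (real (\<Prod>p\<in>P. p ^ (if real p \<le> 256 / be ^ 2 \<or> p \<in> T then c else 0))) =
     real c * (ln (real (\<Prod>p\<in>S. p)) + ln (real (\<Prod>p\<in>T. p)))"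
    unfolding eq using ST by (simp only: ln_realpow mult_pos_pos ln_mult_pos[OF ST])
  also have "\<dots> \<le> real c * (560 / be ^ 2)"
    using lnS lnT by (intro mult_left_mono) auto
  also have "\<dots> \<le> 13 / be ^ 2 * (560 / be ^ 2)"
    using c be by (intro mult_right_mono) auto
  also have "\<dots> = 7280 / be ^ 4"
    by (simp add: power2_eq_square power4_eq_xxxx)
  also have "\<dots> \<le> 8000 / be ^ 4"
    using be by (intro divide_right_mono) auto
  finally have "ln (real (\<Prod>p\<in>P. p ^ (if real p \<le> 256 / be ^ 2 \<or> p \<in> T then c else 0))) \<le> 8000 / be ^ 4" .
  moreover have "real (\<Prod>p\<in>P. p ^ (if real p \<le> 256 / be ^ 2 \<or> p \<in> T then c else 0)) > 0"
    unfolding eq using ST by simp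
  ultimately show ?thesis
    unfolding c_def[symmetric] by (rule le_exp)
qed

section \<open>Passage to a divisor of \<open>q\<close>\<close>

theorem theorem2:
  shows "\<exists>C C' :: real. C > 0 \<and> C' > 0 \<and>
    (\<forall>(q :: nat) (A :: int set) (B :: int set) (\<alpha> :: real) (\<beta> :: real).
      q > 0 \<longrightarrow>
      A \<subseteq> carrier (Zq q) \<longrightarrow> B \<subseteq> carrier (Zq q) \<longrightarrow>
      A \<noteq> {} \<longrightarrow> B \<noteq> {} \<longrightarrow>
      real (card A) = \<alpha> * real q \<longrightarrow> real (card B) = \<beta> * real q \<longrightarrow>
      \<alpha> \<ge> \<beta> \<longrightarrow>
      (\<exists>d :: nat. d dvd q \<and> real d \<le> C' * exp (C * \<beta> powi (-4)) \<and>
        dilate (Zq q) d (carrier (Zq q))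
          \<subseteq> set_minus (Zq q) A A <#>\<^bsub>Zq q\<^esub> set_minus (Zq q) B B))"
proof (rule exI[of _ 8000], rule exI[of _ 1], intro conjI allI impI)
  fix q :: nat and A B :: "int set" and \<alpha> \<beta> :: real
  assume q: "q > 0" and A: "A \<subseteq> carrier (Zq q)" "A \<noteq> {}" and B: "B \<subseteq> carrier (Zq q)" "B \<noteq> {}"
    and al: "real (card A) = \<alpha> * real q" and be: "real (card B) = \<beta> * real q" and le: "\<alpha> \<ge> \<beta>"
  have carrier: "carrier (Zq q) = {0..<int q}"
    by (auto simp: residue_ring_def)
  note A' = A(1)[unfolded carrier] and B' = B(1)[unfolded carrier]
  have finB: "finite B"
    using B' by (rule finite_subset) simp
  have "card B > 0"
    using B finB by (simp add: card_gt_0_iff)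
  then have be0: "\<beta> > 0"
    using be q by (metis of_nat_0_less_iff zero_less_mult_pos2)
  have "card B \<le> card {0..<int q}"
    using B' by (intro card_mono) auto
  then have "\<beta> * real q \<le> 1 * real q"
    using be by simp
  then have be1: "\<beta> \<le> 1"
    using q by (simp only: mult_le_cancel_right_pos of_nat_0_less_iff)
  obtain T where T: "T \<subseteq> {p \<in> prime_factors q. 256 / \<beta> ^ 2 < real p \<and> real p \<le> 256 / \<beta> ^ 8}"
    "real (card T) \<le> 2 / sqrt \<beta> ^ 3"
    and ex: "\<And>t. \<exists>a\<in>A. \<exists>a'\<in>A. \<exists>b\<in>B. \<exists>b'\<in>B. [(a - a') * (b - b') = t * (\<Prod>p\<in>prime_factors q.
        int p ^ (if real p \<le> 256 / \<beta> ^ 2 \<or> p \<in> T then nat \<lceil>12 / \<beta> ^ 2\<rceil> else 0))] (mod int q)"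
    by (rule product_of_differences[OF q A' A(2) B' B(2) al be le]) (rule that; assumption)
  define D where "D = (\<Prod>p\<in>prime_factors q.
    p ^ (if real p \<le> 256 / \<beta> ^ 2 \<or> p \<in> T then nat \<lceil>12 / \<beta> ^ 2\<rceil> else 0))"
  have D0: "D > 0"
    unfolding D_def by (intro prod_pos) (auto dest!: in_prime_factors_imp_prime intro: prime_gt_0_nat)
  have D: "real D \<le> exp (8000 / \<beta> ^ 4)"
    unfolding D_def by (rule divisor_bound[OF be0 be1 _ _ T]) auto
  have exD: "\<exists>a\<in>A. \<exists>a'\<in>A. \<exists>b\<in>B. \<exists>b'\<in>B. [(a - a') * (b - b') = t * int D] (mod int q)" for t
    using ex[of t] by (simp add: D_def)
  \<comment> \<open>\<open>D\<close> itself may fail to divide \<open>q\<close>, but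
    \<open>d\<close> generates the same ideal modulo \<open>q\<close>: by Bezout
    \<open>d * x\<close> is congruent to \<open>(u * x) * D\<close>, so the multiplier
    \<open>t = u * x\<close> reaches every element of the dilate.\<close>
  define d where "d = gcd D q"
  have "real d \<le> real D"
    using D0 by (simp add: d_def gcd_le1_nat)
  also have "\<dots> \<le> 1 * exp (8000 * \<beta> powi (-4))"
    using D by (simp add: power_int_minus divide_inverse)
  finally have d: "real d \<le> 1 * exp (8000 * \<beta> powi (-4))" .
  obtain u v where uv: "u * int D + v * int q = int d"
    using bezout_int[of "int D" "int q"] by (auto simp: d_def)
  show "\<exists>d :: nat. d dvd q \<and> real d \<le> 1 * exp (8000 * \<beta> powi (-4)) \<and>
        dilate (Zq q) d (carrier (Zq q))
          \<subseteq> set_minus (Zq q) A A <#>\<^bsub>Zq q\<^esub> set_minus (Zq q) B B"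
  proof (intro exI[of _ d] conjI d subsetI)
    show "d dvd q"
      by (simp add: d_def)
    fix y assume "y \<in> dilate (Zq q) d (carrier (Zq q))"
    then obtain x where y: "y = (int d * x) mod int q"
      by (auto simp: dilate_def Zq_add_pow)
    obtain a a' b b' where ab: "a \<in> A" "a' \<in> A" "b \<in> B" "b' \<in> B"
      and cong: "[(a - a') * (b - b') = (u * x) * int D] (mod int q)"
      using exD[of "u * x"] by blast
    have "int d * x = (u * x) * int D + int q * (v * x)"
      unfolding uv[symmetric] by (simp add: algebra_simps)
    then have "y = ((u * x) * int D) mod int q"
      unfolding y by simp
    also have "\<dots> = ((a - a') * (b - b')) mod int q"
      using cong by (simp add: cong_def)
    also have "\<dots> = ((a - a') mod int q) \<otimes>\<^bsub>Zq q\<^esub> ((b - b') mod int q)"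
      by (simp add: residue_ring_def mod_mult_eq)
    finally have y': "y = ((a - a') mod int q) \<otimes>\<^bsub>Zq q\<^esub> ((b - b') mod int q)" .
    have diff: "(x - x') mod int q \<in> set_minus (Zq q) X X"
      if "X \<subseteq> carrier (Zq q)" "x \<in> X" "x' \<in> X" for x x' X
    proof -
      have "(x - x') mod int q = x \<ominus>\<^bsub>Zq q\<^esub> x'"
        by (rule Zq_minus[OF q, symmetric]) (use that in blast)+
      then show ?thesis
        unfolding set_minus_def mem_Collect_eq
        using that(2,3) by (intro exI[of _ x] exI[of _ x'] conjI)
    qed
    show "y \<in> set_minus (Zq q) A A <#>\<^bsub>Zq q\<^esub> set_minus (Zq q) B B"
      unfolding y' set_mult_def
      by (rule UN_I[OF diff[OF A(1) ab(1,2)] UN_I[OF diff[OF B(1) ab(3,4)] singletonI]])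
  qed
qed simp_all

end
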